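(* Let $n\ge1$ and let $A_0$ and $A_k,B_k$ ($k\ge1$) be smooth $\mathbb{R}_{0,m}$-valued functions depending only on $\underline{y}$, such that the series below and its termwise derivatives converge. Suppose $\Delta^nA_k=0$ for all $k\ge0$ and, for $k\ge1$, $$B_k=\sum_{j=1}^{\min(n,\lfloor (k+1)/2\rfloor)}\frac{c_j}{(2j-1)!\binom{k}{k-2j+1}}\,\partial_{\underline{y}}^{2j-1}A_{k-2j+1},$$ where $c_1=-\frac12$ and $c_j=-\frac{1}{2^j}\sum_{l=1}^{\lfloor j/2\rfloor}\sum_{i=1}^{l}\binom{j+1}{2l+1}\binom{l}{i}c_{j-i}$ for $j\ge2$. Then $$F(X)=A_0(\underline{y})+\sum_{k=1}^\infty\big(z^kA_k(\underline{y})+\overline{z}^kB_k(\underline{y})\big)$$ is left $n$-monogenic, i.e. $\partial_X^nF=0$.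
   Context: Let $m\ge 2$ and let $\mathbb{R}_{0,m}$ be the real Clifford algebra generated by $e_1,\dots,e_m$ with $e_i^2=-1$ and $e_ie_j=-e_je_i$ for $i\neq j$; all products are Clifford products. Identify $(x_0,\dots,x_m)\in\mathbb{R}^{m+1}$ with $X=x_0+\sum_{j=1}^m x_je_j$, and write $z=x_0+x_1e_1$, $\overline{z}=x_0-x_1e_1$, $\underline{y}=\sum_{j=2}^m x_je_j$. Operators: $\partial_X f=\partial_{x_0}f+\sum_{j=1}^m e_j\partial_{x_j}f$, $\partial_{\underline{y}}f=\sum_{j=2}^m e_j\partial_{x_j}f$; powers denote iterated left application. $\Delta=\sum_{j=2}^m\partial_{x_j}^2=-\partial_{\underline{y}}^2$. *)

theory Defs
  imports "HOL-Analysis.Analysis"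
begin

text \<open>An element of R_{0,m} is represented by its coordinates with respect to the
basis blades e_A = e_{a1} ... e_{ak} (a1 < ... < ak), A a subset of {1..m}.
Coordinates at sets A that are not subsets of {1..m} are meant to be 0
(see cl_elem).\<close>

type_synonym cl = "nat set \<Rightarrow> real"

definition cl_elem :: "nat \<Rightarrow> cl \<Rightarrow> bool" where
  "cl_elem m u \<longleftrightarrow> (\<forall>C. \<not> C \<subseteq> {1..m} \<longrightarrow> u C = 0)"

text \<open>Sign in e_A e_B = blade_sign A B e_{A symmetric-difference B}, for e_i^2 = -1 and
anticommuting generators.\<close>
definition blade_sign :: "nat set \<Rightarrow> nat set \<Rightarrow> real" where
  "blade_sign A B = (-1) ^ (card {(a, b). a \<in> A \<and> b \<in> B \<and> b < a} + card (A \<inter> B))"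

definition cl_mult :: "nat \<Rightarrow> cl \<Rightarrow> cl \<Rightarrow> cl" where
  "cl_mult m u v = (\<lambda>C. \<Sum>A\<in>Pow {1..m}. \<Sum>B\<in>Pow {1..m}.
      (if (A - B) \<union> (B - A) = C then blade_sign A B * u A * v B else 0))"

definition cl_add :: "cl \<Rightarrow> cl \<Rightarrow> cl" where
  "cl_add u v = (\<lambda>C. u C + v C)"

definition cl_scale :: "real \<Rightarrow> cl \<Rightarrow> cl" where
  "cl_scale r u = (\<lambda>C. r * u C)"

definition cl_scalar :: "real \<Rightarrow> cl" where
  "cl_scalar r = (\<lambda>C. if C = {} then r else 0)"

definition cl_zero :: cl where
  "cl_zero = (\<lambda>C. 0)"

definition cl_e :: "nat \<Rightarrow> cl" where
  "cl_e j = (\<lambda>C. if C = {j} then 1 else 0)"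

primrec cl_pow :: "nat \<Rightarrow> cl \<Rightarrow> nat \<Rightarrow> cl" where
  "cl_pow m u 0 = cl_scalar 1"
| "cl_pow m u (Suc k) = cl_mult m u (cl_pow m u k)"

text \<open>Points X = x_0 + sum x_j e_j are coordinate functions x :: nat => real
(only x 0, ..., x m matter).  z = x_0 + x_1 e_1 and its conjugate.\<close>
definition zc :: "(nat \<Rightarrow> real) \<Rightarrow> cl" where
  "zc x = (\<lambda>C. if C = {} then x 0 else if C = {1} then x 1 else 0)"

definition zbar :: "(nat \<Rightarrow> real) \<Rightarrow> cl" where
  "zbar x = (\<lambda>C. if C = {} then x 0 else if C = {1} then - x 1 else 0)"

definition pd_real :: "nat \<Rightarrow> ((nat \<Rightarrow> real) \<Rightarrow> real) \<Rightarrow> (nat \<Rightarrow> real) \<Rightarrow> real" where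
  "pd_real j g x = deriv (\<lambda>t. g (x(j := t))) (x j)"

fun ipd_real :: "nat list \<Rightarrow> ((nat \<Rightarrow> real) \<Rightarrow> real) \<Rightarrow> (nat \<Rightarrow> real) \<Rightarrow> real" where
  "ipd_real [] g = g"
| "ipd_real (j # js) g = pd_real j (ipd_real js g)"

definition pd :: "nat \<Rightarrow> ((nat \<Rightarrow> real) \<Rightarrow> cl) \<Rightarrow> (nat \<Rightarrow> real) \<Rightarrow> cl" where
  "pd j G x = (\<lambda>C. pd_real j (\<lambda>y. G y C) x)"

definition smooth_real_on :: "nat \<Rightarrow> (nat \<Rightarrow> real) set \<Rightarrow> ((nat \<Rightarrow> real) \<Rightarrow> real) \<Rightarrow> bool" where
  "smooth_real_on m \<Omega> g \<longleftrightarrow>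
     (\<forall>js. set js \<subseteq> {..m} \<longrightarrow>
        continuous_on \<Omega> (ipd_real js g) \<and>
        (\<forall>x\<in>\<Omega>. \<forall>j\<le>m. (\<lambda>t. ipd_real js g (x(j := t))) differentiable (at (x j))))"

definition smooth_cl_on :: "nat \<Rightarrow> (nat \<Rightarrow> real) set \<Rightarrow> ((nat \<Rightarrow> real) \<Rightarrow> cl) \<Rightarrow> bool" where
  "smooth_cl_on m \<Omega> G \<longleftrightarrow> (\<forall>C. smooth_real_on m \<Omega> (\<lambda>x. G x C))"

definition DX :: "nat \<Rightarrow> ((nat \<Rightarrow> real) \<Rightarrow> cl) \<Rightarrow> (nat \<Rightarrow> real) \<Rightarrow> cl" where
  "DX m G x = (\<lambda>C. pd 0 G x C + (\<Sum>j\<in>{1..m}. cl_mult m (cl_e j) (pd j G x) C))"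

definition Dy :: "nat \<Rightarrow> ((nat \<Rightarrow> real) \<Rightarrow> cl) \<Rightarrow> (nat \<Rightarrow> real) \<Rightarrow> cl" where
  "Dy m G x = (\<lambda>C. \<Sum>j\<in>{2..m}. cl_mult m (cl_e j) (pd j G x) C)"

definition Lap :: "nat \<Rightarrow> ((nat \<Rightarrow> real) \<Rightarrow> cl) \<Rightarrow> (nat \<Rightarrow> real) \<Rightarrow> cl" where
  "Lap m G x = (\<lambda>C. \<Sum>j\<in>{2..m}. pd j (pd j G) x C)"

function coef_c :: "nat \<Rightarrow> real" where
  "coef_c j = (if j \<le> 1 then - 1 / 2
     else - (1 / 2 ^ j) * (\<Sum>l\<in>{1..j div 2}. \<Sum>i\<in>{1..l}.
            real ((j + 1) choose (2 * l + 1)) * real (l choose i) * coef_c (j - i)))"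
  by auto
termination
  by (relation "Wellfounded.measure id") auto

lemma coef_c_1: "coef_c 1 = - 1 / 2"
  by simp

definition sterm :: "nat \<Rightarrow> (nat \<Rightarrow> (nat \<Rightarrow> real) \<Rightarrow> cl) \<Rightarrow> (nat \<Rightarrow> (nat \<Rightarrow> real) \<Rightarrow> cl)
    \<Rightarrow> nat \<Rightarrow> (nat \<Rightarrow> real) \<Rightarrow> cl" where
  "sterm m A B k x = cl_add (cl_mult m (cl_pow m (zc x) k) (A k x))
                            (cl_mult m (cl_pow m (zbar x) k) (B k x))"

definition Fser :: "nat \<Rightarrow> (nat \<Rightarrow> (nat \<Rightarrow> real) \<Rightarrow> cl) \<Rightarrow> (nat \<Rightarrow> (nat \<Rightarrow> real) \<Rightarrow> cl)
    \<Rightarrow> (nat \<Rightarrow> real) \<Rightarrow> cl" where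
  "Fser m A B x = (\<lambda>C. A 0 x C + (\<Sum>k. sterm m A B (Suc k) x C))"

end

theory Submission
  imports Defs "HOL-Computational_Algebra.Formal_Power_Series"
begin

text \<open>
Write D for the operator Dy, and put w(l, q) = D^q (z^l A / l!) for a function A of the variables
x_2, ..., x_m only. Since e_j z = conj(z) e_j for j > 1, the operator DX acts by
DX w(l, q) = w(l, q + 1) + (1 - (-1)^q) w(l - 1, q).

The coefficients are c_j = - binom(1/2, j). Indeed, for s = sqrt(1 + t) and j > 1 the binomial
expansion gives (1 - s)^(j+1) = Q - s P with polynomials P, Q in t of degree less than j, and t
divides 1 - s, so the coefficient of t^j in P (1 - s) = P - Q + (1 - s)^(j+1) vanishes; this is the
recursion for c_j. Hence
h = sum c_j t^j = 1 - sqrt(1 + t) satisfies h^2 = 2 h + t, and therefore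
g(k, q) = w(k, q) + sum_j c_j w(k + 2j - 1, q + 2j - 1) satisfies, for even q,
DX g(k, q) = sum_i c_i g(k + 2i - 1, q + 2i). Each DX raises q by at least 2 and D^(2n) A = 0, so
DX^n g(k, 0) = 0.

The series F is the sum of k! g(k, 0) over all A = A_k, in a different order. After applying DX^n
termwise, the partial sums of the two arrangements differ by a bounded number of boundary terms.
These tend to 0: the operator d/dx_0 - e_1 d/dx_1 kills the powers of conj(z) and differentiates
those of z, so convergence of all derivatives of the series bounds k! w(k - p, q) for A = A_k.
\<close>

subsection \<open>The coefficients\<close>

text \<open>The quadratic relation comes from asking DX to send towers to combinations of towers.
  Let t stand for the shift of (l, q) to (l + 2, q + 2). For even q, DX g consists of even-order
  blocks weighted by h and odd-order blocks weighted by 1 + 2 h / t. This is h applied to towers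
  exactly when 1 + 2 h / t = h^2 / t. Of the two roots, only the one with h(0) = 0 makes DX raise q,
  and its first coefficient is c_1 = -1/2. The analytic obstacle is that only the combined series of
  the terms z^k A_k + conj(z)^k B_k is assumed to converge, with its derivatives, locally uniformly.
  Nothing is assumed about absolute convergence or about the two halves separately, so collecting
  the terms by A_k has to go through finite partial sums. Dividing z^l by l! makes the coefficients
  in the action of DX independent of l, hence decay of the boundary terms survives n applications of
  DX.\<close>

declare coef_c.simps [simp del]

lemma fps_binomial_half_sq: "(fps_binomial (1/2 :: real))\<^sup>2 = 1 + fps_X"
proof -
  have "(fps_binomial (1/2 :: real))\<^sup>2 = fps_binomial 1"
    by (simp add: power2_eq_square flip: fps_binomial_add_mult)
  then show ?thesis by (simp add: fps_binomial_1)
qed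

lemma one_plus_X_power_nth: "fps_nth ((1 + fps_X :: real fps) ^ l) i = real (l choose i)"
proof -
  have "(1 + fps_X :: real fps) ^ l = fps_binomial (of_nat l)"
    by (simp add: fps_binomial_of_nat)
  then show ?thesis by (simp add: binomial_gbinomial)
qed

lemma sum_even_odd:
  fixes f :: "nat \<Rightarrow> 'a::comm_monoid_add"
  shows "(\<Sum>i\<le>n. f i) = (\<Sum>l\<le>n div 2. f (2 * l)) + (\<Sum>l<(n + 1) div 2. f (2 * l + 1))"
proof (induction n)
  case (Suc n)
  show ?case
  proof (cases "even n")
    case True
    then obtain r where "n = 2 * r" by auto
    then show ?thesis using Suc by (simp add: ac_simps)
  next
    case False
    then obtain r where "n = 2 * r + 1" using oddE by blast
    then show ?thesis using Suc by (simp add: ac_simps)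
  qed
qed simp

lemma coef_c_gbinomial:
  assumes "j \<ge> 1"
  shows "coef_c j = - ((1/2) gchoose j)"
  using assms
proof (induction j rule: less_induct)
  case (less j)
  show ?case
  proof (cases "j = 1")
    case True
    then show ?thesis by (simp add: coef_c.simps)
  next
    case False
    with less.prems have j: "j \<ge> 2" by simp
    define s where "s = fps_binomial (1/2 :: real)"
    define P where "P = (\<Sum>l\<le>j div 2. of_nat ((j+1) choose (2*l+1)) * (1 + fps_X :: real fps) ^ l)"
    define Q where "Q = (\<Sum>l\<le>(j+1) div 2. of_nat ((j+1) choose (2*l)) * (1 + fps_X :: real fps) ^ l)"
    have s2: "s\<^sup>2 = 1 + fps_X" unfolding s_def by (rule fps_binomial_half_sq)
    have "(1 - s) ^ (j+1) = (\<Sum>i\<le>j+1. of_nat ((j+1) choose i) * (- s) ^ i)"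
      using binomial_ring[of "- s" 1 "j+1"] by simp
    also have "\<dots> = Q - P * s"
    proof -
      have ev: "(-s) ^ (2*l) = (1 + fps_X) ^ l" for l
        by (simp add: power_mult s2)
      have od: "(-s) ^ (2*l+1) = - (s * (1 + fps_X) ^ l)" for l
        by (simp add: power_mult s2)
      have e: "{..<(j + 1 + 1) div 2} = {..j div 2}"
        by auto
      show ?thesis
        unfolding sum_even_odd[of _ "j+1"] ev od e P_def Q_def
        by (simp add: sum_distrib_left sum_negf ac_simps)
    qed
    finally have "P * (1 - s) = P - Q + (1 - s) ^ (j+1)"
      by (simp add: algebra_simps)
    then have "fps_nth (P * (1 - s)) j = fps_nth P j - fps_nth Q j + fps_nth ((1 - s) ^ (j+1)) j"
      by simp
    also have "fps_nth P j = 0"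
      using j by (auto simp: P_def fps_sum_nth fps_of_nat[symmetric] one_plus_X_power_nth
          intro!: sum.neutral)
    \<comment> \<open>The degree of \<open>Q\<close> is at most \<open>(j+1) div 2\<close>, which is
      below \<open>j\<close> only from \<open>j = 2\<close> on; hence the separate case
      \<open>j = 1\<close>.\<close>
    also have "fps_nth Q j = 0"
      using j by (auto simp: Q_def fps_sum_nth fps_of_nat[symmetric] one_plus_X_power_nth
          intro!: sum.neutral)
    \<comment> \<open>\<open>1 - s\<close> has no constant term, so its power starts in degree
      \<open>j+1\<close> at the earliest.\<close>
    also have "fps_nth ((1 - s) ^ (j+1)) j = 0"
      by (intro startsby_zero_power_prefix[rule_format]) (auto simp: s_def)
    finally have "fps_nth (P * (1 - s)) j = 0" by simp
    moreover have "fps_nth (P * (1 - s)) j = (\<Sum>l\<le>j div 2. \<Sum>i\<le>l.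
        real ((j+1) choose (2*l+1)) * real (l choose i) * (- ((1/2) gchoose (j - i))))"
    proof -
      have "fps_nth ((1 + fps_X :: real fps) ^ l * (1 - s)) j
          = (\<Sum>i\<le>l. real (l choose i) * (- ((1/2) gchoose (j - i))))" if "l \<le> j div 2" for l
      proof -
        have "fps_nth ((1 + fps_X :: real fps) ^ l * (1 - s)) j
          = (\<Sum>i\<in>{0..j}. real (l choose i) * (fps_nth (1 - s) (j - i)))"
          by (simp add: fps_mult_nth one_plus_X_power_nth)
        also have "\<dots> = (\<Sum>i\<le>l. real (l choose i) * (fps_nth (1 - s) (j - i)))"
          using that by (intro sum.mono_neutral_right) auto
        also have "\<dots> = (\<Sum>i\<le>l. real (l choose i) * (- ((1/2) gchoose (j - i))))"
          using that j by (intro sum.cong) (auto simp: s_def)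
        finally show ?thesis .
      qed
      then show ?thesis
        by (simp add: P_def sum_distrib_right fps_sum_nth mult.assoc fps_of_nat[symmetric]
            sum_distrib_left)
    qed
    ultimately have "0 = (\<Sum>l\<le>j div 2. \<Sum>i\<le>l.
        real ((j+1) choose (2*l+1)) * real (l choose i) * (- ((1/2) gchoose (j - i))))"
      by simp
    \<comment> \<open>Only \<open>i = 0\<close> involves the unknown coefficient of index
      \<open>j\<close>; splitting it off solves the equation for it.\<close>
    also have "\<dots> = (\<Sum>l\<le>j div 2. real ((j+1) choose (2*l+1))) * (- ((1/2) gchoose j))
       + (\<Sum>l\<le>j div 2. \<Sum>i\<in>{1..l}.
        real ((j+1) choose (2*l+1)) * real (l choose i) * (- ((1/2) gchoose (j - i))))"
    proof -
      have e: "(\<Sum>i\<le>l. f i) = f 0 + (\<Sum>i\<in>{1..l}. f i)" for l and f :: "nat \<Rightarrow> real"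
      proof -
        have "{..l} = insert 0 {1..l}" by auto
        then show ?thesis by simp
      qed
      have "(\<Sum>l\<le>j div 2. \<Sum>i\<le>l.
          real ((j+1) choose (2*l+1)) * real (l choose i) * (- ((1/2) gchoose (j - i))))
        = (\<Sum>l\<le>j div 2. real ((j+1) choose (2*l+1)) * (- ((1/2) gchoose j)) + (\<Sum>i\<in>{1..l}.
          real ((j+1) choose (2*l+1)) * real (l choose i) * (- ((1/2) gchoose (j - i)))))"
        by (intro sum.cong refl, subst e) simp
      then show ?thesis
        by (simp only: sum.distrib sum_distrib_right)
    qed
    \<comment> \<open>The odd entries of row \<open>j+1\<close> of Pascal's triangle make up half of
      \<open>2 ^ (j+1)\<close>. This is the origin of the factor \<open>1 / 2 ^ j\<close> in the
      recursion.\<close>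
    also have "(\<Sum>l\<le>j div 2. real ((j+1) choose (2*l+1))) = 2 ^ j"
    proof -
      have "2 * (\<Sum>i\<le>j+1. if odd i then real ((j+1) choose i) else 0) = 2 ^ (j+1)"
        by (rule choose_odd_sum) simp
      moreover have "(\<Sum>i\<le>j+1. if odd i then real ((j+1) choose i) else 0)
          = (\<Sum>l<(j+1+1) div 2. real ((j+1) choose (2*l+1)))"
        by (subst sum_even_odd) simp
      moreover have "{..<(j + 1 + 1) div 2} = {..j div 2}"
        by auto
      ultimately have "2 * (\<Sum>l\<le>j div 2. real ((j+1) choose (2*l+1))) = 2 ^ (j+1)"
        by (simp only:)
      then show ?thesis by simp
    qed
    also have "(\<Sum>l\<le>j div 2. \<Sum>i\<in>{1..l}.
        real ((j+1) choose (2*l+1)) * real (l choose i) * (- ((1/2) gchoose (j - i))))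
      = (\<Sum>l\<in>{1..j div 2}. \<Sum>i\<in>{1..l}.
        real ((j+1) choose (2*l+1)) * real (l choose i) * coef_c (j - i))"
    proof (rule sum.mono_neutral_cong_right)
      fix l assume l: "l \<in> {1..j div 2}"
      show "(\<Sum>i\<in>{1..l}. real ((j+1) choose (2*l+1)) * real (l choose i) * (- ((1/2) gchoose (j - i))))
        = (\<Sum>i\<in>{1..l}. real ((j+1) choose (2*l+1)) * real (l choose i) * coef_c (j - i))"
      proof (rule sum.cong[OF refl])
        fix i assume "i \<in> {1..l}"
        then have "coef_c (j - i) = - ((1/2) gchoose (j - i))"
          using l j by (intro less.IH) auto
        then show "real ((j+1) choose (2*l+1)) * real (l choose i) * (- ((1/2) gchoose (j - i)))
          = real ((j+1) choose (2*l+1)) * real (l choose i) * coef_c (j - i)" by simp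
      qed
    qed auto
    finally show ?thesis
      using j by (subst coef_c.simps) (simp add: field_simps)
  qed
qed

text \<open>Comparison of coefficients of degree \<open>s\<close> in h^2 = 2 h + t. In degree 1 the
  summand t contributes as well; it reappears as the isolated term \<open>\<beta> 1\<close> in
  \<open>coef_c_double_sum\<close>.\<close>

lemma coef_c_convolution:
  assumes "s \<ge> 2"
  shows "2 * coef_c s = (\<Sum>i\<in>{1..s-1}. coef_c i * coef_c (s - i))"
proof -
  define h where "h = 1 - fps_binomial (1/2 :: real)"
  have h: "fps_nth h i = (if i = 0 then 0 else coef_c i)" for i
    by (simp add: h_def coef_c_gbinomial)
  have "h * h = 2 * h + fps_X"
    using fps_binomial_half_sq by (simp add: h_def power2_eq_square algebra_simps)
  then have "fps_nth (h * h) s = 2 * coef_c s"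
    using assms by (simp add: h)
  then have "2 * coef_c s = (\<Sum>i\<in>{0..s}. fps_nth h i * fps_nth h (s - i))"
    by (simp add: fps_mult_nth)
  also have "\<dots> = (\<Sum>i\<in>{1..s-1}. coef_c i * coef_c (s - i))"
    by (rule sum.mono_neutral_cong_right) (auto simp: h)
  finally show ?thesis .
qed

subsection \<open>Left multiplication by generators and complex numbers\<close>

text \<open>Symmetric difference with \<open>{j}\<close>: up to sign, left multiplication by e_j
  permutes the blades by this involution.\<close>

definition flip :: "nat \<Rightarrow> nat set \<Rightarrow> nat set" where
  "flip j C = (if j \<in> C then C - {j} else insert j C)"

text \<open>The sign in e_j e_B = esgn j C e_C for B = flip j C.\<close>

definition esgn :: "nat \<Rightarrow> nat set \<Rightarrow> real" where
  "esgn j C = (-1) ^ card {b \<in> C. b < j} * (if j \<in> C then 1 else -1)"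

lemma flip_flip [simp]: "flip j (flip j C) = C"
  by (auto simp: flip_def)

lemma flip_commute: "flip i (flip j C) = flip j (flip i C)"
  by (auto simp: flip_def)

lemma flip_subset: "1 \<le> j \<Longrightarrow> j \<le> m \<Longrightarrow> flip j C \<subseteq> {Suc 0..m} \<longleftrightarrow> C \<subseteq> {Suc 0..m}"
  by (auto simp: flip_def split: if_splits)

text \<open>This is e_j^2 = -1 in coordinates: toggling \<open>j\<close> leaves the indices below
  \<open>j\<close> alone, and \<open>j\<close> lies in exactly one of the two sets.\<close>

lemma esgn_flip_same: "esgn j C * esgn j (flip j C) = -1"
proof -
  have "{b \<in> flip j C. b < j} = {b \<in> C. b < j}"
    by (auto simp: flip_def split: if_splits)
  moreover have "j \<in> flip j C \<longleftrightarrow> j \<notin> C"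
    by (auto simp: flip_def)
  ultimately show ?thesis
    by (auto simp: esgn_def simp flip: power_mult_distrib)
qed

text \<open>Toggling the smaller index \<open>i\<close> changes the number of indices below
  \<open>j\<close> by one, while toggling \<open>j\<close> is invisible to the count below
  \<open>i\<close>. The single change of parity is the minus sign.\<close>

lemma esgn_flip_anticommute:
  assumes "i < j" "finite C"
  shows "esgn i C * esgn j (flip i C) = - (esgn j C * esgn i (flip j C))"
proof -
  have 1: "{b \<in> flip j C. b < i} = {b \<in> C. b < i}"
    using assms by (auto simp: flip_def split: if_splits)
  have 2: "i \<in> flip j C \<longleftrightarrow> i \<in> C" "j \<in> flip i C \<longleftrightarrow> j \<in> C"
    using assms by (auto simp: flip_def)
  have 3: "(-1 :: real) ^ card {b \<in> flip i C. b < j} = - ((-1) ^ card {b \<in> C. b < j})"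
  proof (cases "i \<in> C")
    case True
    then have "{b \<in> C. b < j} = insert i {b \<in> flip i C. b < j}" "i \<notin> {b \<in> flip i C. b < j}"
      using assms by (auto simp: flip_def)
    moreover have "finite {b \<in> flip i C. b < j}"
      using assms by (auto simp: flip_def)
    ultimately show ?thesis by simp
  next
    case False
    then have "{b \<in> flip i C. b < j} = insert i {b \<in> C. b < j}" "i \<notin> {b \<in> C. b < j}"
      using assms by (auto simp: flip_def)
    moreover have "finite {b \<in> C. b < j}"
      using assms by auto
    ultimately show ?thesis by simp
  qed
  show ?thesis
    unfolding esgn_def 1 2 3 by simp
qed

lemma blade_sign_singleton_flip: "blade_sign {j} (flip j C) = esgn j C"
proof -
  have "{(a, b). a \<in> {j} \<and> b \<in> flip j C \<and> b < a} = Pair j ` {b \<in> C. b < j}"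
    by (auto simp: flip_def split: if_splits)
  then have "card {(a, b). a \<in> {j} \<and> b \<in> flip j C \<and> b < a} = card {b \<in> C. b < j}"
    by (simp add: card_image inj_on_def)
  moreover have "{j} \<inter> flip j C = (if j \<in> C then {} else {j})"
    by (auto simp: flip_def)
  ultimately show ?thesis
    by (simp add: blade_sign_def esgn_def power_add)
qed

text \<open>The double sum collapses to one blade, so later identities with generators can be
  checked one coordinate at a time. Outside subsets of \<open>{1..m}\<close> the product is 0
  whatever \<open>u\<close> is.\<close>

lemma cl_mult_e:
  assumes "j \<in> {1..m}"
  shows "cl_mult m (cl_e j) u C = (if C \<subseteq> {1..m} then esgn j C * u (flip j C) else 0)"
proof -
  have "cl_mult m (cl_e j) u C = (\<Sum>A\<in>Pow {1..m}. if A = {j} then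
      (\<Sum>B\<in>Pow {1..m}. if (A - B) \<union> (B - A) = C then blade_sign A B * u B else 0) else 0)"
    unfolding cl_mult_def
  proof (intro sum.cong refl)
    fix A
    show "(\<Sum>B\<in>Pow {1..m}. if (A - B) \<union> (B - A) = C then blade_sign A B * cl_e j A * u B else 0)
      = (if A = {j} then
      (\<Sum>B\<in>Pow {1..m}. if (A - B) \<union> (B - A) = C then blade_sign A B * u B else 0) else 0)"
      by (cases "A = {j}") (simp_all add: cl_e_def cong: if_cong)
  qed
  also have "\<dots> = (\<Sum>B\<in>Pow {1..m}. if ({j} - B) \<union> (B - {j}) = C then blade_sign {j} B * u B else 0)"
    using assms by (subst sum.delta) auto
  also have "\<dots> = (\<Sum>B\<in>Pow {1..m}. if B = flip j C then blade_sign {j} B * u B else 0)"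
  proof (intro sum.cong refl)
    fix B
    have "({j} - B) \<union> (B - {j}) = flip j B"
      by (auto simp: flip_def)
    moreover have "flip j B = C \<longleftrightarrow> B = flip j C"
      by (metis flip_flip)
    ultimately show "(if ({j} - B) \<union> (B - {j}) = C then blade_sign {j} B * u B else 0)
        = (if B = flip j C then blade_sign {j} B * u B else 0)" by simp
  qed
  also have "\<dots> = (if C \<subseteq> {1..m} then esgn j C * u (flip j C) else 0)"
    using flip_subset[of j m C] assms by (simp add: blade_sign_singleton_flip)
  finally show ?thesis .
qed

lemma cl_mult_e_linear:
  assumes "j \<in> {1..m}"
  shows "cl_mult m (cl_e j) (\<lambda>C. a * u C + b * v C) C
    = a * cl_mult m (cl_e j) u C + b * cl_mult m (cl_e j) v C"
  by (simp add: cl_mult_e[OF assms] algebra_simps)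

lemma cl_elem_mult_e: "j \<in> {1..m} \<Longrightarrow> cl_elem m (cl_mult m (cl_e j) u)"
  by (simp add: cl_elem_def cl_mult_e)

lemma cl_mult_e_e_same:
  assumes "cl_elem m u" "j \<in> {1..m}"
  shows "cl_mult m (cl_e j) (cl_mult m (cl_e j) u) C = - u C"
proof (cases "C \<subseteq> {1..m}")
  case True
  then show ?thesis
    using assms esgn_flip_same[of j C]
    by (simp add: cl_mult_e flip_subset mult.assoc[symmetric])
next
  case False
  then show ?thesis
    using assms by (simp add: cl_mult_e cl_elem_def)
qed

lemma cl_mult_e_e_anticommute:
  assumes "i \<in> {1..m}" "j \<in> {1..m}" "i \<noteq> j"
  shows "cl_mult m (cl_e i) (cl_mult m (cl_e j) u) C = - cl_mult m (cl_e j) (cl_mult m (cl_e i) u) C"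
proof (cases "C \<subseteq> {1..m}")
  case True
  then have "finite C" using finite_subset by blast
  then have "esgn i C * esgn j (flip i C) = - (esgn j C * esgn i (flip j C))"
    using assms esgn_flip_anticommute[of i j C] esgn_flip_anticommute[of j i C]
    by (cases "i < j") auto
  then show ?thesis
    using assms True
    by (simp add: cl_mult_e flip_subset mult.assoc[symmetric] flip_commute[of i j])
next
  case False
  then show ?thesis
    using assms by (simp add: cl_mult_e)
qed

text \<open>Since e_1^2 = -1, the span of 1 and e_1 is a copy of the complex numbers; this is its
  action by left multiplication. Having the scalar as a \<open>complex\<close> gives access to the
  library's powers, conjugation and derivatives.\<close>

definition cmul :: "nat \<Rightarrow> complex \<Rightarrow> cl \<Rightarrow> cl" where
  "cmul m w u = (\<lambda>C. Re w * u C + Im w * cl_mult m (cl_e 1) u C)"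

lemma cmul_cmul:
  assumes "m \<ge> 1" "cl_elem m u"
  shows "cmul m v (cmul m w u) = cmul m (v * w) u"
proof
  fix C
  have *: "cl_mult m (cl_e 1) (cmul m w u) C = Re w * cl_mult m (cl_e 1) u C - Im w * u C"
    using assms cl_mult_e_e_same[of m u 1 C]
    by (simp add: cmul_def cl_mult_e_linear)
  show "cmul m v (cmul m w u) C = cmul m (v * w) u C"
    unfolding cmul_def[of m v] cmul_def[of m "v * w"] * by (simp add: cmul_def algebra_simps)
qed

lemma cl_mult_e1_cmul:
  assumes "m \<ge> 1" "cl_elem m u"
  shows "cl_mult m (cl_e 1) (cmul m w u) = cmul m (\<i> * w) u"
  using cmul_cmul[OF assms, of \<i> w] by (simp add: cmul_def[of m \<i>])

lemma cl_mult_e_cmul: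
  assumes "j \<in> {2..m}"
  shows "cl_mult m (cl_e j) (cmul m w u) = cmul m (cnj w) (cl_mult m (cl_e j) u)"
proof
  fix C
  have "cl_mult m (cl_e 1) (cl_mult m (cl_e j) u) C = - cl_mult m (cl_e j) (cl_mult m (cl_e 1) u) C"
    using assms by (intro cl_mult_e_e_anticommute) auto
  moreover have "cl_mult m (cl_e j) (cmul m w u) C
      = Re w * cl_mult m (cl_e j) u C + Im w * cl_mult m (cl_e j) (cl_mult m (cl_e 1) u) C"
    using assms by (simp add: cl_mult_e_linear cmul_def)
  ultimately show "cl_mult m (cl_e j) (cmul m w u) C = cmul m (cnj w) (cl_mult m (cl_e j) u) C"
    by (simp add: cmul_def)
qed

lemma cmul_sum:
  assumes "m \<ge> 1"
  shows "cmul m w (\<lambda>C. \<Sum>i\<in>I. a i * u i C) = (\<lambda>C. \<Sum>i\<in>I. a i * cmul m w (u i) C)"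
  using assms by (auto simp: cmul_def cl_mult_e sum_distrib_left sum.distrib algebra_simps)

lemma cmul_of_real_mult: "cmul m (of_real r * w) u C = r * cmul m w u C"
  by (simp add: cmul_def algebra_simps)

definition cl_of_complex :: "complex \<Rightarrow> cl" where
  "cl_of_complex w = (\<lambda>C. if C = {} then Re w else if C = {1} then Im w else 0)"

text \<open>Multiplication by a scalar through \<open>cl_mult\<close> erases the coordinates outside
  subsets of \<open>{1..m}\<close>, whereas \<open>cmul\<close> keeps them in its real part; on
  genuine Clifford elements the two agree.\<close>

lemma cl_mult_of_complex:
  assumes "m \<ge> 1" "cl_elem m u"
  shows "cl_mult m (cl_of_complex w) u = cmul m w u"
proof
  fix C
  have "cl_mult m (cl_of_complex w) u C = cl_mult m (cl_scalar (Re w)) u C + Im w * cl_mult m (cl_e 1) u C"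
    unfolding cl_mult_def sum.distrib[symmetric] sum_distrib_left
  proof (intro sum.cong refl)
    fix A B
    show "(if A - B \<union> (B - A) = C then blade_sign A B * cl_of_complex w A * u B else 0)
      = (if A - B \<union> (B - A) = C then blade_sign A B * cl_scalar (Re w) A * u B else 0)
        + Im w * (if A - B \<union> (B - A) = C then blade_sign A B * cl_e 1 A * u B else 0)"
      by (simp add: cl_of_complex_def cl_scalar_def cl_e_def)
  qed
  moreover have "cl_mult m (cl_scalar (Re w)) u C = Re w * u C"
  proof -
    have "cl_mult m (cl_scalar (Re w)) u C = (\<Sum>A\<in>Pow {1..m}. if A = {} then
        (\<Sum>B\<in>Pow {1..m}. if B = C then Re w * u B else 0) else 0)"
      unfolding cl_mult_def
    proof (intro sum.cong refl)
      fix A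
      show "(\<Sum>B\<in>Pow {1..m}. if (A - B) \<union> (B - A) = C
            then blade_sign A B * cl_scalar (Re w) A * u B else 0)
        = (if A = {} then (\<Sum>B\<in>Pow {1..m}. if B = C then Re w * u B else 0) else 0)"
        by (cases "A = {}") (simp_all add: cl_scalar_def blade_sign_def cong: if_cong)
    qed
    also have "\<dots> = (\<Sum>B\<in>Pow {1..m}. if B = C then Re w * u B else 0)"
      by (subst sum.delta) auto
    also have "\<dots> = Re w * u C"
      using assms(2) by (simp add: cl_elem_def)
    finally show ?thesis .
  qed
  ultimately show "cl_mult m (cl_of_complex w) u C = cmul m w u C"
    by (simp add: cmul_def)
qed

lemma cl_elem_of_complex: "m \<ge> 1 \<Longrightarrow> cl_elem m (cl_of_complex w)"
  unfolding cl_elem_def cl_of_complex_def by (metis atLeastAtMost_iff empty_subsetI insert_subset order_refl)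

lemma cmul_of_complex:
  assumes "m \<ge> 1"
  shows "cmul m v (cl_of_complex w) = cl_of_complex (v * w)"
proof
  fix C
  have "flip 1 {} = {1}" "flip 1 {1} = {}" "flip 1 C = {} \<longleftrightarrow> C = flip 1 {}" "flip 1 C = {1} \<longleftrightarrow> C = flip 1 {1}"
    by (simp add: flip_def, simp add: flip_def, (metis flip_flip)+)
  then have *: "flip 1 C = {} \<longleftrightarrow> C = {1}" "flip 1 C = {1} \<longleftrightarrow> C = {}"
    by simp_all
  have e: "esgn 1 {} = -1" "esgn 1 {1} = 1"
  proof -
    have "{b \<in> {1::nat}. b < 1} = {}" by auto
    then show "esgn 1 {1} = 1" unfolding esgn_def by (simp only:) simp
  qed (simp add: esgn_def)
  consider "C = {}" | "C = {1}" | "C \<noteq> {}" "C \<noteq> {1}" by blast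
  then show "cmul m v (cl_of_complex w) C = cl_of_complex (v * w) C"
    using assms * e by cases (simp_all add: cmul_def cl_mult_e cl_of_complex_def flip_def)
qed

lemma cl_pow_of_complex:
  assumes "m \<ge> 1"
  shows "cl_pow m (cl_of_complex w) k = cl_of_complex (w ^ k)"
proof (induction k)
  case 0
  show ?case by (auto simp: cl_of_complex_def cl_scalar_def)
next
  case (Suc k)
  then show ?case
    using assms by (simp add: cl_mult_of_complex cl_elem_of_complex cmul_of_complex)
qed

subsection \<open>Smooth functions of finitely many coordinates\<close>

lemma ipd_real_append: "ipd_real (js @ ks) f = ipd_real js (ipd_real ks f)"
  by (induction js) auto

lemma continuous_on_fun_upd: "continuous_on S (\<lambda>t. (x :: nat \<Rightarrow> real)(j := t))"
proof (rule continuous_on_coordinatewise_then_product)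
  fix i show "continuous_on S (\<lambda>t. (x(j := t)) i)"
    by (cases "i = j") (auto intro!: continuous_intros)
qed

text \<open>Openness refers to the product topology on all of \<open>nat \<Rightarrow> real\<close>.
  Every coordinate line or plane through a point of \<open>\<Omega>\<close> therefore meets
  \<open>\<Omega>\<close> in an open set, which is what local arguments with partial derivatives
  require.\<close>

locale open_domain =
  fixes m :: nat and \<Omega> :: "(nat \<Rightarrow> real) set"
  assumes open_Omega: "open \<Omega>"
begin

abbreviation smooth :: "((nat \<Rightarrow> real) \<Rightarrow> real) \<Rightarrow> bool" where
  "smooth \<equiv> smooth_real_on m \<Omega>"

lemma open_line: "open U \<Longrightarrow> open {t. (x :: nat \<Rightarrow> real)(j := t) \<in> U}"
  using open_vimage[of U, OF _ continuous_on_fun_upd[of UNIV x j]] by (simp add: vimage_def)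

lemma eventually_line: "x \<in> \<Omega> \<Longrightarrow> eventually (\<lambda>t. x(j := t) \<in> \<Omega>) (nhds (x j))"
  using eventually_nhds_in_open[OF open_line[OF open_Omega, of x j], of "x j"] by simp

lemma pd_real_cong:
  assumes "\<And>x. x \<in> \<Omega> \<Longrightarrow> f x = g x" "x \<in> \<Omega>"
  shows "pd_real j f x = pd_real j g x"
  unfolding pd_real_def
  using assms(1) by (intro deriv_cong_ev refl eventually_mono[OF eventually_line[OF assms(2), of j]]) auto

lemma ipd_real_cong:
  assumes "\<And>x. x \<in> \<Omega> \<Longrightarrow> f x = g x" "x \<in> \<Omega>"
  shows "ipd_real js f x = ipd_real js g x"
  using assms(2)
proof (induction js arbitrary: x)
  case (Cons j js)
  then show ?case using pd_real_cong[of "ipd_real js f" "ipd_real js g" x j] by simp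
qed (use assms in simp)

lemma differentiable_line_cong:
  assumes "\<And>x. x \<in> \<Omega> \<Longrightarrow> f x = g x" "x \<in> \<Omega>"
    and "(\<lambda>t. f (x(j := t)) :: real) differentiable (at (x j))"
  shows "(\<lambda>t. g (x(j := t))) differentiable (at (x j))"
proof -
  obtain D where D: "((\<lambda>t. f (x(j := t))) has_field_derivative D) (at (x j))"
    using assms(3) real_differentiable_def by blast
  have "((\<lambda>t. g (x(j := t))) has_field_derivative D) (at (x j))"
    using D assms(1)
    by (subst DERIV_cong_ev[OF refl _ refl, of _ "\<lambda>t. f (x(j := t))"])
      (auto intro!: eventually_mono[OF eventually_line[OF assms(2), of j]])
  then show ?thesis using real_differentiable_def by blast
qed

lemma smooth_continuous: "smooth f \<Longrightarrow> continuous_on \<Omega> f"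
  unfolding smooth_real_on_def by (drule spec[of _ "[]"]) simp

lemma smooth_has_pd:
  assumes "smooth f" "x \<in> \<Omega>" "j \<le> m"
  shows "((\<lambda>t. f (x(j := t))) has_field_derivative pd_real j f x) (at (x j))"
proof -
  have "(\<lambda>t. f (x(j := t))) differentiable (at (x j))"
    using assms spec[where x = "[]", OF assms(1)[unfolded smooth_real_on_def]] by simp
  then show ?thesis
    unfolding pd_real_def using DERIV_deriv_iff_real_differentiable by blast
qed

lemma smooth_has_pd_at:
  assumes "smooth f" "x(j := s) \<in> \<Omega>" "j \<le> m"
  shows "((\<lambda>t. f (x(j := t))) has_field_derivative pd_real j f (x(j := s))) (at s)"
  using smooth_has_pd[OF assms] by simp

lemma smooth_ipd:
  assumes "smooth f" "set ks \<subseteq> {..m}"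
  shows "smooth (ipd_real ks f)"
  unfolding smooth_real_on_def ipd_real_append[symmetric]
proof (intro allI impI)
  fix js assume "set js \<subseteq> {..m}"
  then have "set (js @ ks) \<subseteq> {..m}" using assms(2) by simp
  then show "continuous_on \<Omega> (ipd_real (js @ ks) f) \<and>
    (\<forall>x\<in>\<Omega>. \<forall>j\<le>m. (\<lambda>t. ipd_real (js @ ks) f (x(j := t))) differentiable (at (x j)))"
    using spec[where x = "js @ ks", OF assms(1)[unfolded smooth_real_on_def]] by blast
qed

lemma smooth_pd: "smooth f \<Longrightarrow> j \<le> m \<Longrightarrow> smooth (pd_real j f)"
  using smooth_ipd[of f "[j]"] by simp

text \<open>Smoothness is the largest class of continuous, partially differentiable functions closed
  under partial derivatives. Closure is asked only up to equality on \<open>\<Omega>\<close>,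
  because \<open>pd_real\<close> is uncontrolled elsewhere.\<close>

lemma smooth_coinduct:
  assumes "P f"
    and cont: "\<And>f. P f \<Longrightarrow> continuous_on \<Omega> f"
    and diff: "\<And>f x j. P f \<Longrightarrow> x \<in> \<Omega> \<Longrightarrow> j \<le> m \<Longrightarrow> (\<lambda>t. f (x(j := t))) differentiable (at (x j))"
    and step: "\<And>f j. P f \<Longrightarrow> j \<le> m \<Longrightarrow> \<exists>g. P g \<and> (\<forall>x\<in>\<Omega>. pd_real j f x = g x)"
  shows "smooth f"
proof -
  have *: "\<exists>g. P g \<and> (\<forall>x\<in>\<Omega>. ipd_real js f x = g x)" if "set js \<subseteq> {..m}" for js
    using that
  proof (induction js)
    case Nil
    then show ?case using assms(1) by auto
  next
    case (Cons j js)
    then obtain g where g: "P g" "\<And>x. x \<in> \<Omega> \<Longrightarrow> ipd_real js f x = g x" by auto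
    obtain h where h: "P h" "\<And>x. x \<in> \<Omega> \<Longrightarrow> pd_real j g x = h x"
      using step[OF g(1), of j] Cons.prems by auto
    show ?case using h pd_real_cong[OF g(2)] by auto
  qed
  show ?thesis
    unfolding smooth_real_on_def
  proof (intro allI impI conjI ballI)
    fix js assume "set js \<subseteq> {..m}"
    then obtain g where g: "P g" "\<And>x. x \<in> \<Omega> \<Longrightarrow> ipd_real js f x = g x" using * by blast
    show "continuous_on \<Omega> (ipd_real js f)"
      using continuous_on_eq[OF cont[OF g(1)]] g(2) by simp
    fix x j assume x: "x \<in> \<Omega>" "j \<le> m"
    show "(\<lambda>t. ipd_real js f (x(j := t))) differentiable (at (x j))"
      by (rule differentiable_line_cong[OF g(2)[symmetric] x(1) diff[OF g(1) x]])
  qed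
qed

text \<open>By the product rule, derivatives of these functions are again of this form, which makes the
  family a coinduction invariant for smoothness.\<close>

inductive smooth_alg :: "((nat \<Rightarrow> real) \<Rightarrow> real) \<Rightarrow> bool" where
  base: "smooth f \<Longrightarrow> smooth_alg f"
| add: "smooth_alg f \<Longrightarrow> smooth_alg g \<Longrightarrow> smooth_alg (\<lambda>x. f x + g x)"
| mult: "smooth_alg f \<Longrightarrow> smooth_alg g \<Longrightarrow> smooth_alg (\<lambda>x. f x * g x)"

lemma smooth_alg_step:
  assumes "smooth_alg f"
  shows "continuous_on \<Omega> f \<and> (\<forall>j\<le>m. \<exists>g. smooth_alg g \<and>
    (\<forall>x\<in>\<Omega>. ((\<lambda>t. f (x(j := t))) has_field_derivative g x) (at (x j))))"
  using assms
proof induction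
  case (base f)
  show ?case
  proof (intro conjI allI impI)
    fix j assume j: "j \<le> m"
    show "\<exists>g. smooth_alg g \<and> (\<forall>x\<in>\<Omega>. ((\<lambda>t. f (x(j := t))) has_field_derivative g x) (at (x j)))"
      using smooth_has_pd[OF base _ j] smooth_alg.base[OF smooth_pd[OF base j]] by (intro exI[of _ "pd_real j f"]) simp
  qed (rule smooth_continuous[OF base])
next
  case (add f g)
  show ?case
  proof (intro conjI allI impI)
    show "continuous_on \<Omega> (\<lambda>x. f x + g x)"
      using add.IH by (intro continuous_intros) auto
    fix j assume "j \<le> m"
    then obtain f' g' where
      f': "smooth_alg f'" "\<forall>x\<in>\<Omega>. ((\<lambda>t. f (x(j := t))) has_field_derivative f' x) (at (x j))" and
      g': "smooth_alg g'" "\<forall>x\<in>\<Omega>. ((\<lambda>t. g (x(j := t))) has_field_derivative g' x) (at (x j))"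
      using add.IH by blast
    show "\<exists>h. smooth_alg h \<and> (\<forall>x\<in>\<Omega>. ((\<lambda>t. f (x(j := t)) + g (x(j := t))) has_field_derivative h x) (at (x j)))"
      using f'(2) g'(2) smooth_alg.add[OF f'(1) g'(1)]
      by (intro exI[of _ "\<lambda>x. f' x + g' x"]) (simp add: DERIV_add)
  qed
next
  case (mult f g)
  show ?case
  proof (intro conjI allI impI)
    show "continuous_on \<Omega> (\<lambda>x. f x * g x)"
      using mult.IH by (intro continuous_intros) auto
    fix j assume "j \<le> m"
    then obtain f' g' where
      f': "smooth_alg f'" "\<forall>x\<in>\<Omega>. ((\<lambda>t. f (x(j := t))) has_field_derivative f' x) (at (x j))" and
      g': "smooth_alg g'" "\<forall>x\<in>\<Omega>. ((\<lambda>t. g (x(j := t))) has_field_derivative g' x) (at (x j))"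
      using mult.IH by blast
    have "((\<lambda>t. f (x(j := t)) * g (x(j := t))) has_field_derivative f' x * g x + g' x * f x) (at (x j))"
      if "x \<in> \<Omega>" for x
      using DERIV_mult[of "\<lambda>t. f (x(j := t))" "f' x" "x j" UNIV "\<lambda>t. g (x(j := t))" "g' x"] f' g' that
      by simp
    moreover have "smooth_alg (\<lambda>x. f' x * g x + g' x * f x)"
      by (rule smooth_alg.add[OF smooth_alg.mult[OF f'(1) mult.hyps(2)] smooth_alg.mult[OF g'(1) mult.hyps(1)]])
    ultimately show "\<exists>h. smooth_alg h \<and> (\<forall>x\<in>\<Omega>. ((\<lambda>t. f (x(j := t)) * g (x(j := t))) has_field_derivative h x) (at (x j)))"
      by blast
  qed
qed

lemma smooth_alg_smooth: "smooth_alg f \<Longrightarrow> smooth f"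
proof (erule smooth_coinduct[where P = smooth_alg])
  fix f assume f: "smooth_alg f"
  show "continuous_on \<Omega> f" using smooth_alg_step[OF f] by blast
  fix j assume "j \<le> m"
  then obtain g where g: "smooth_alg g"
    "\<And>x. x \<in> \<Omega> \<Longrightarrow> ((\<lambda>t. f (x(j := t))) has_field_derivative g x) (at (x j))"
    using smooth_alg_step[OF f] by blast
  show "(\<lambda>t. f (x(j := t))) differentiable (at (x j))" if "x \<in> \<Omega>" for x
    using g(2)[OF that] real_differentiable_def by blast
  show "\<exists>g. smooth_alg g \<and> (\<forall>x\<in>\<Omega>. pd_real j f x = g x)"
    unfolding pd_real_def using g(1) DERIV_imp_deriv[OF g(2)] by (intro exI[of _ g]) simp
qed

lemma smooth_add: "smooth f \<Longrightarrow> smooth g \<Longrightarrow> smooth (\<lambda>x. f x + g x)"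
  using smooth_alg_smooth[OF smooth_alg.add[OF smooth_alg.base smooth_alg.base]] .

lemma smooth_mult: "smooth f \<Longrightarrow> smooth g \<Longrightarrow> smooth (\<lambda>x. f x * g x)"
  using smooth_alg_smooth[OF smooth_alg.mult[OF smooth_alg.base smooth_alg.base]] .

lemma pd_real_const: "pd_real j (\<lambda>x. c) = (\<lambda>x. 0)"
  by (intro ext) (simp add: pd_real_def)

lemma smooth_const: "smooth (\<lambda>x. c)"
  by (rule smooth_coinduct[where P = "\<lambda>f. \<exists>c. f = (\<lambda>x. c)"]) (auto simp: pd_real_const)

lemma smooth_coord: "smooth (\<lambda>x. x i)"
proof (rule smooth_coinduct[where P = "\<lambda>f. f = (\<lambda>x. x i) \<or> (\<exists>c. f = (\<lambda>x. c))"])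
  fix f :: "(nat \<Rightarrow> real) \<Rightarrow> real" and j
  assume f: "f = (\<lambda>x. x i) \<or> (\<exists>c. f = (\<lambda>x. c))"
  then show "continuous_on \<Omega> f"
    using continuous_on_subset[OF continuous_on_product_coordinates[of i] subset_UNIV, of \<Omega>] by auto
  have *: "((\<lambda>t. (x(j := t)) i) has_field_derivative (if i = j then 1 else 0)) (at (x j))" for x :: "nat \<Rightarrow> real"
    by (cases "i = j") auto
  show "(\<lambda>t. f (x(j := t))) differentiable (at (x j))" for x
    using f *[of x] unfolding real_differentiable_def by (auto intro: DERIV_const)
  have "pd_real j (\<lambda>x. x i) = (\<lambda>x. if i = j then 1 else 0)"
    unfolding pd_real_def by (intro ext DERIV_imp_deriv *)
  then show "\<exists>g. (g = (\<lambda>x. x i) \<or> (\<exists>c. g = (\<lambda>x. c))) \<and> (\<forall>x\<in>\<Omega>. pd_real j f x = g x)"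
    using f pd_real_const by metis
qed auto

lemma smooth_sum: "(\<And>i. i \<in> I \<Longrightarrow> smooth (f i)) \<Longrightarrow> smooth (\<lambda>x. \<Sum>i\<in>I. f i x)"
  by (induction I rule: infinite_finite_induct) (auto intro!: smooth_const smooth_add)

lemma smooth_scale: "smooth f \<Longrightarrow> smooth (\<lambda>x. c * f x)"
  by (intro smooth_mult smooth_const)

section \<open>Linearity and symmetry of iterated partial derivatives\<close>

lemma pd_real_lincomb:
  assumes "\<And>i. i \<in> I \<Longrightarrow> smooth (f i)" "x \<in> \<Omega>" "j \<le> m"
  shows "pd_real j (\<lambda>x. \<Sum>i\<in>I. a i * f i x) x = (\<Sum>i\<in>I. a i * pd_real j (f i) x)"
proof -
  have "((\<lambda>t. \<Sum>i\<in>I. a i * f i (x(j := t))) has_field_derivative (\<Sum>i\<in>I. a i * pd_real j (f i) x)) (at (x j))"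
    using assms by (intro DERIV_sum DERIV_cmult smooth_has_pd)
  then show ?thesis
    unfolding pd_real_def by (rule DERIV_imp_deriv)
qed

text \<open>One weighted finite sum covers all uses of linearity: index set \<open>{}\<close> gives
  the zero function, \<open>{0}\<close> scaling, and \<open>{True, False}\<close> sums and
  differences. The later linearity lemmas follow the same pattern.\<close>

lemma ipd_real_lincomb:
  assumes "\<And>i. i \<in> I \<Longrightarrow> smooth (f i)" "x \<in> \<Omega>" "set js \<subseteq> {..m}"
  shows "ipd_real js (\<lambda>x. \<Sum>i\<in>I. a i * f i x) x = (\<Sum>i\<in>I. a i * ipd_real js (f i) x)"
  using assms(2,3)
proof (induction js arbitrary: x)
  case (Cons j js)
  have "ipd_real (j # js) (\<lambda>x. \<Sum>i\<in>I. a i * f i x) x = pd_real j (\<lambda>x. \<Sum>i\<in>I. a i * ipd_real js (f i) x) x"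
    using Cons by (simp add: pd_real_cong[of "ipd_real js (\<lambda>x. \<Sum>i\<in>I. a i * f i x)" "\<lambda>x. \<Sum>i\<in>I. a i * ipd_real js (f i) x"])
  also have "\<dots> = (\<Sum>i\<in>I. a i * pd_real j (ipd_real js (f i)) x)"
    using Cons.prems assms(1) by (intro pd_real_lincomb smooth_ipd) auto
  finally show ?case by simp
qed simp

text \<open>The mean value theorem in both variables turns the second difference over a rectangle into a
  mixed derivative at an inner point; it is symmetric in the two variables.\<close>

lemma second_difference:
  assumes f: "smooth f" and ij: "i \<noteq> j" "i \<le> m" "j \<le> m" and h: "h > 0"
    and box: "\<And>s t. a \<le> s \<Longrightarrow> s \<le> a + h \<Longrightarrow> b \<le> t \<Longrightarrow> t \<le> b + h \<Longrightarrow> x(i := s, j := t) \<in> \<Omega>"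
  shows "\<exists>s t. a < s \<and> s < a + h \<and> b < t \<and> t < b + h \<and>
    f (x(i := a + h, j := b + h)) - f (x(i := a, j := b + h))
    - (f (x(i := a + h, j := b)) - f (x(i := a, j := b)))
    = h * h * pd_real j (pd_real i f) (x(i := s, j := t))"
proof -
  have di: "((\<lambda>s. f (x(i := s, j := t))) has_field_derivative pd_real i f (x(i := s, j := t))) (at s)"
    if "a \<le> s" "s \<le> a + h" "b \<le> t" "t \<le> b + h" for s t
    using smooth_has_pd_at[OF f, of "x(j := t)" i s] box[OF that] ij fun_upd_twist[of i j x] by simp
  have dj: "((\<lambda>t. pd_real i f (x(i := s, j := t))) has_field_derivative pd_real j (pd_real i f) (x(i := s, j := t))) (at t)"
    if "a \<le> s" "s \<le> a + h" "b \<le> t" "t \<le> b + h" for s t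
    using smooth_has_pd_at[OF smooth_pd[OF f], of i "x(i := s)" j t] box[OF that] ij by simp
  have "((\<lambda>s. f (x(i := s, j := b + h)) - f (x(i := s, j := b))) has_field_derivative
      pd_real i f (x(i := s, j := b + h)) - pd_real i f (x(i := s, j := b))) (at s)"
    if "a \<le> s" "s \<le> a + h" for s
    using di[OF that, of "b + h"] di[OF that, of b] h by (intro DERIV_diff) auto
  then obtain s where s: "a < s" "s < a + h" "(f (x(i := a + h, j := b + h)) - f (x(i := a + h, j := b)))
      - (f (x(i := a, j := b + h)) - f (x(i := a, j := b)))
      = (a + h - a) * (pd_real i f (x(i := s, j := b + h)) - pd_real i f (x(i := s, j := b)))"
    using MVT2[of a "a + h" "\<lambda>s. f (x(i := s, j := b + h)) - f (x(i := s, j := b))"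
        "\<lambda>s. pd_real i f (x(i := s, j := b + h)) - pd_real i f (x(i := s, j := b))"] h
    by auto
  obtain t where t: "b < t" "t < b + h" "pd_real i f (x(i := s, j := b + h)) - pd_real i f (x(i := s, j := b))
      = (b + h - b) * pd_real j (pd_real i f) (x(i := s, j := t))"
    using MVT2[of b "b + h" "\<lambda>t. pd_real i f (x(i := s, j := t))"
        "\<lambda>t. pd_real j (pd_real i f) (x(i := s, j := t))"] dj h s
    by auto
  show ?thesis
    using s t by (intro exI[of _ s] exI[of _ t]) (simp add: algebra_simps)
qed

lemma continuous_on_fun_upd2: "continuous_on S (\<lambda>p. (x :: nat \<Rightarrow> real)(i := fst p, j := snd p))"
proof (rule continuous_on_coordinatewise_then_product)
  fix k show "continuous_on S (\<lambda>p. (x(i := fst p, j := snd p)) k)"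
    by (cases "k = j"; cases "k = i") (auto intro!: continuous_intros)
qed

lemma plane_box:
  fixes x :: "nat \<Rightarrow> real"
  assumes "open U" "x \<in> U"
  shows "\<exists>h>0. \<forall>s t. x i \<le> s \<longrightarrow> s \<le> x i + h \<longrightarrow> x j \<le> t \<longrightarrow> t \<le> x j + h \<longrightarrow> x(i := s, j := t) \<in> U"
proof -
  have "open ((\<lambda>p. x(i := fst p, j := snd p)) -` U)"
    using assms(1) by (intro open_vimage continuous_on_fun_upd2)
  moreover have "(x i, x j) \<in> (\<lambda>p. x(i := fst p, j := snd p)) -` U"
    using assms(2) by simp
  ultimately obtain V W where "open V" "open W" "(x i, x j) \<in> V \<times> W"
    "V \<times> W \<subseteq> (\<lambda>p. x(i := fst p, j := snd p)) -` U"
    by (rule open_prod_elim)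
  then have VW: "open V" "open W" "x i \<in> V" "x j \<in> W"
    "V \<times> W \<subseteq> (\<lambda>p. x(i := fst p, j := snd p)) -` U"
    by auto
  obtain d e where de: "d > 0" "cball (x i) d \<subseteq> V" "e > 0" "cball (x j) e \<subseteq> W"
    using VW open_contains_cball[of V] open_contains_cball[of W] by blast
  have "x(i := s, j := t) \<in> U"
    if "x i \<le> s" "s \<le> x i + min d e" "x j \<le> t" "t \<le> x j + min d e" for s t
  proof -
    have "s \<in> V" "t \<in> W"
      using that de by (auto simp: dist_real_def subset_iff)
    then show ?thesis using VW(5) by auto
  qed
  then show ?thesis using de by (intro exI[of _ "min d e"]) auto
qed

text \<open>The second difference over a small square at \<open>x\<close> can be evaluated in either
  order. This equates the two mixed derivatives at two possibly different inner points, and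
  continuity of both carries the equality to \<open>x\<close>.\<close>

lemma pd_real_commute:
  assumes f: "smooth f" and x: "x \<in> \<Omega>" and ij: "i \<le> m" "j \<le> m"
  shows "pd_real i (pd_real j f) x = pd_real j (pd_real i f) x"
proof (cases "i = j")
  case False
  define g1 g2 where "g1 = pd_real j (pd_real i f)" and "g2 = pd_real i (pd_real j f)"
  have c: "continuous_on \<Omega> g1" "continuous_on \<Omega> g2"
    unfolding g1_def g2_def by (intro smooth_continuous smooth_pd f ij)+
  have "\<bar>g1 x - g2 x\<bar> \<le> e" if "e > 0" for e
  proof -
    \<comment> \<open>On \<open>U\<close> both mixed derivatives are within \<open>e / 2\<close> of
      their values at \<open>x\<close>, so one square inside \<open>U\<close> serves both
      evaluations.\<close>
    define U where "U = \<Omega> \<inter> {y \<in> \<Omega>. \<bar>g1 y - g1 x\<bar> < e / 2} \<inter> {y \<in> \<Omega>. \<bar>g2 y - g2 x\<bar> < e / 2}"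
    have op: "open {y \<in> \<Omega>. \<bar>g y - g x\<bar> < e / 2}" if "continuous_on \<Omega> g" for g :: "(nat \<Rightarrow> real) \<Rightarrow> real"
    proof -
      have "open (\<Omega> \<inter> g -` ball (g x) (e/2))"
        using that open_Omega by (intro continuous_open_preimage) auto
      moreover have "\<Omega> \<inter> g -` ball (g x) (e/2) = {y \<in> \<Omega>. \<bar>g y - g x\<bar> < e / 2}"
        by (auto simp: dist_real_def abs_minus_commute)
      ultimately show ?thesis by simp
    qed
    have "open U" unfolding U_def using op c open_Omega by (intro open_Int) auto
    moreover have "x \<in> U" using x that by (simp add: U_def)
    ultimately obtain h where h: "h > 0" "\<And>s t. x i \<le> s \<Longrightarrow> s \<le> x i + h \<Longrightarrow> x j \<le> t \<Longrightarrow> t \<le> x j + h \<Longrightarrow> x(i := s, j := t) \<in> U"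
      using plane_box by meson
    have tw: "x(j := t, i := s) = x(i := s, j := t)" for s t
      using False by (simp add: fun_upd_twist)
    define Q where "Q = f (x(i := x i + h, j := x j + h)) - f (x(i := x i, j := x j + h))
        - (f (x(i := x i + h, j := x j)) - f (x(i := x i, j := x j)))"
    have box: "x(i := s, j := t) \<in> \<Omega>"
      if "x i \<le> s" "s \<le> x i + h" "x j \<le> t" "t \<le> x j + h" for s t
      using h(2)[OF that] by (simp add: U_def)
    obtain s t where st: "x i < s" "s < x i + h" "x j < t" "t < x j + h" "Q = h * h * g1 (x(i := s, j := t))"
      using second_difference[OF f False ij h(1) box] unfolding g1_def Q_def by blast
    have box': "x(j := t, i := s) \<in> \<Omega>"
      if "x j \<le> t" "t \<le> x j + h" "x i \<le> s" "s \<le> x i + h" for s t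
      unfolding tw using that by (intro box)
    obtain t' s' where st': "x j < t'" "t' < x j + h" "x i < s'" "s' < x i + h"
      "f (x(j := x j + h, i := x i + h)) - f (x(j := x j, i := x i + h))
        - (f (x(j := x j + h, i := x i)) - f (x(j := x j, i := x i))) = h * h * g2 (x(j := t', i := s'))"
      using second_difference[OF f False[symmetric] ij(2,1) h(1) box'] unfolding g2_def by blast
    have "Q = h * h * g2 (x(i := s', j := t'))"
      using st'(5) unfolding tw Q_def by linarith
    then have eq: "g1 (x(i := s, j := t)) = g2 (x(i := s', j := t'))"
      using st(5) h(1) by simp
    have "x(i := s, j := t) \<in> U" "x(i := s', j := t') \<in> U"
      using st st' by (auto intro!: h(2))
    then have "\<bar>g1 (x(i := s, j := t)) - g1 x\<bar> < e / 2" "\<bar>g2 (x(i := s', j := t')) - g2 x\<bar> < e / 2"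
      unfolding U_def by auto
    then show ?thesis unfolding eq by linarith
  qed
  then have "\<bar>g1 x - g2 x\<bar> \<le> 0" using field_le_epsilon[of "\<bar>g1 x - g2 x\<bar>" 0] by simp
  then show ?thesis by (simp add: g1_def g2_def)
qed simp

text \<open>Pointwise convergence of every iterated derivative is stable under differential
  operators by its very form. Uniform convergence enters only once, in
  \<open>smooth_limit_series\<close>.\<close>

definition smooth_limit :: "(nat \<Rightarrow> (nat \<Rightarrow> real) \<Rightarrow> real) \<Rightarrow> ((nat \<Rightarrow> real) \<Rightarrow> real) \<Rightarrow> bool" where
  "smooth_limit S f \<longleftrightarrow> (\<forall>k. smooth (S k)) \<and> smooth f \<and>
     (\<forall>js x. set js \<subseteq> {..m} \<longrightarrow> x \<in> \<Omega> \<longrightarrow> (\<lambda>k. ipd_real js (S k) x) \<longlonglongrightarrow> ipd_real js f x)"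

lemma smooth_limit_pd:
  assumes "smooth_limit S f" "j \<le> m"
  shows "smooth_limit (\<lambda>k. pd_real j (S k)) (pd_real j f)"
proof -
  have "ipd_real js (pd_real j g) = ipd_real (js @ [j]) g" for js g
    by (simp add: ipd_real_append)
  then show ?thesis
    using assms by (auto simp: smooth_limit_def smooth_pd simp del: ipd_real.simps)
qed

lemma smooth_limit_lincomb:
  assumes "\<And>i. i \<in> I \<Longrightarrow> smooth_limit (S i) (f i)"
  shows "smooth_limit (\<lambda>k x. \<Sum>i\<in>I. a i * S i k x) (\<lambda>x. \<Sum>i\<in>I. a i * f i x)"
  unfolding smooth_limit_def
proof (intro conjI allI impI)
  have sm: "smooth (S i k)" "smooth (f i)" if "i \<in> I" for i k
    using assms[OF that] by (auto simp: smooth_limit_def)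
  show "smooth (\<lambda>x. \<Sum>i\<in>I. a i * S i k x)" for k
    using sm by (intro smooth_sum smooth_scale)
  show "smooth (\<lambda>x. \<Sum>i\<in>I. a i * f i x)"
    using sm by (intro smooth_sum smooth_scale)
  fix js x assume js: "set js \<subseteq> {..m}" and x: "x \<in> \<Omega>"
  have "(\<lambda>k. \<Sum>i\<in>I. a i * ipd_real js (S i k) x) \<longlonglongrightarrow> (\<Sum>i\<in>I. a i * ipd_real js (f i) x)"
    using assms js x by (intro tendsto_sum tendsto_mult tendsto_const) (auto simp: smooth_limit_def)
  then show "(\<lambda>k. ipd_real js (\<lambda>x. \<Sum>i\<in>I. a i * S i k x) x) \<longlonglongrightarrow> ipd_real js (\<lambda>x. \<Sum>i\<in>I. a i * f i x) x"
    using ipd_real_lincomb[where I = I and js = js and x = x and a = a] sm x js by simp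
qed

lemma smooth_limit_Suc:
  assumes "smooth_limit S f"
  shows "smooth_limit (\<lambda>k. S (Suc k)) f"
  unfolding smooth_limit_def
proof (intro conjI allI impI)
  fix js x assume "set js \<subseteq> {..m}" "x \<in> \<Omega>"
  then have "(\<lambda>k. ipd_real js (S k) x) \<longlonglongrightarrow> ipd_real js f x"
    using assms by (simp add: smooth_limit_def)
  then show "(\<lambda>k. ipd_real js (S (Suc k)) x) \<longlonglongrightarrow> ipd_real js f x"
    by (rule LIMSEQ_Suc)
qed (use assms in \<open>simp_all add: smooth_limit_def\<close>)

lemma smooth_limit_const: "smooth f \<Longrightarrow> smooth_limit (\<lambda>_. f) f"
  by (simp add: smooth_limit_def)

text \<open>The neighbourhood \<open>U\<close> may depend on the derivative and on the point. This
  suffices because termwise differentiation is applied along one coordinate line at a time, on an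
  interval of that line that stays in \<open>U\<close>.\<close>

lemma smooth_limit_series:
  assumes f: "\<And>k. smooth (f k)"
    and conv: "\<And>js x. set js \<subseteq> {..m} \<Longrightarrow> x \<in> \<Omega> \<Longrightarrow> \<exists>U. open U \<and> x \<in> U \<and> U \<subseteq> \<Omega> \<and>
      uniformly_convergent_on U (\<lambda>N y. \<Sum>k<N. ipd_real js (f k) y)"
  shows "smooth_limit (\<lambda>N x. \<Sum>k<N. f k x) (\<lambda>x. \<Sum>k. f k x)"
proof -
  \<comment> \<open>\<open>g js\<close> is the candidate for the derivative \<open>js\<close> of the
    sum; \<open>deriv\<close> links \<open>g js\<close> to \<open>g (j # js)\<close>, and induction
    on the list then identifies all derivatives.\<close>
  define g where "g js x = (\<Sum>k. ipd_real js (f k) x)" for js x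
  have lim: "\<exists>U. open U \<and> x \<in> U \<and> U \<subseteq> \<Omega> \<and> uniform_limit U (\<lambda>N y. \<Sum>k<N. ipd_real js (f k) y) (g js) sequentially"
    if "set js \<subseteq> {..m}" "x \<in> \<Omega>" for js x
    using conv[OF that] unfolding uniformly_convergent_uniform_limit_iff g_def suminf_eq_lim .
  have sums: "(\<lambda>k. ipd_real js (f k) x) sums g js x" if "set js \<subseteq> {..m}" "x \<in> \<Omega>" for js x
  proof -
    obtain U where "x \<in> U" "uniform_limit U (\<lambda>N y. \<Sum>k<N. ipd_real js (f k) y) (g js) sequentially"
      using lim[OF \<open>set js \<subseteq> {..m}\<close> \<open>x \<in> \<Omega>\<close>] by blast
    then show ?thesis
      unfolding sums_def using tendsto_uniform_limitI by fast
  qed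
  have cont: "continuous_on \<Omega> (g js)" if js: "set js \<subseteq> {..m}" for js
  proof (intro continuous_at_imp_continuous_on ballI)
    fix x assume "x \<in> \<Omega>"
    then obtain U where U: "open U" "x \<in> U" "U \<subseteq> \<Omega>"
      "uniform_limit U (\<lambda>N y. \<Sum>k<N. ipd_real js (f k) y) (g js) sequentially"
      using lim[OF js] by blast
    have "continuous_on U (\<lambda>y. \<Sum>k<N. ipd_real js (f k) y)" for N
      using U(3) by (intro continuous_on_sum continuous_on_subset[OF smooth_continuous[OF smooth_ipd[OF f js]]])
    then have "continuous_on U (g js)"
      by (intro uniform_limit_theorem[OF _ U(4)]) auto
    then show "isCont (g js) x"
      using U continuous_on_eq_continuous_at by blast
  qed
  have deriv: "((\<lambda>t. g js (x(j := t))) has_field_derivative g (j # js) x) (at (x j))"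
    if js: "set js \<subseteq> {..m}" and x: "x \<in> \<Omega>" and j: "j \<le> m" for js x j
  proof -
    have js': "set (j # js) \<subseteq> {..m}" using js j by simp
    obtain U where U: "open U" "x \<in> U" "U \<subseteq> \<Omega>"
      "uniform_limit U (\<lambda>N y. \<Sum>k<N. ipd_real (j # js) (f k) y) (g (j # js)) sequentially"
      using lim[OF js' x] by blast
    have "open {t. x(j := t) \<in> U}" "x j \<in> {t. x(j := t) \<in> U}"
      using U open_line by auto
    then obtain e where e: "e > 0" "ball (x j) e \<subseteq> {t. x(j := t) \<in> U}"
      using open_contains_ball by blast
    have "uniform_limit (ball (x j) e) (\<lambda>N t. \<Sum>k<N. ipd_real (j # js) (f k) (x(j := t)))
        (\<lambda>t. g (j # js) (x(j := t))) sequentially"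
    proof (rule uniform_limitI)
      fix r :: real assume "r > 0"
      from uniform_limitD[OF U(4) this]
      show "\<forall>\<^sub>F N in sequentially. \<forall>t\<in>ball (x j) e.
        dist (\<Sum>k<N. ipd_real (j # js) (f k) (x(j := t))) (g (j # js) (x(j := t))) < r"
        by (rule eventually_mono) (use e(2) in blast)
    qed
    then have uc: "uniformly_convergent_on (ball (x j) e) (\<lambda>N t. \<Sum>k<N. ipd_real (j # js) (f k) (x(j := t)))"
      using uniformly_convergent_on_def by blast
    have d: "((\<lambda>t. ipd_real js (f k) (x(j := t))) has_field_derivative ipd_real (j # js) (f k) (x(j := t)))
        (at t within ball (x j) e)" if "t \<in> ball (x j) e" for k t
    proof -
      have xt: "x(j := t) \<in> \<Omega>" using that e U by blast
      show ?thesis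
        using has_field_derivative_at_within[OF smooth_has_pd_at[OF smooth_ipd[OF f js] xt j]] by simp
    qed
    have "((\<lambda>t. \<Sum>k. ipd_real js (f k) (x(j := t))) has_field_derivative
        (\<Sum>k. ipd_real (j # js) (f k) (x(j := x j)))) (at (x j))"
      by (rule has_field_derivative_series'(2)[where ?x0.0 = "x j", OF convex_ball d uc])
        (use e sums[OF js x] in \<open>auto simp: sums_iff interior_open\<close>)
    then show ?thesis by (simp add: g_def)
  qed
  have ipd: "ipd_real js (g []) x = g js x" if "set js \<subseteq> {..m}" "x \<in> \<Omega>" for js x
    using that
  proof (induction js arbitrary: x)
    case (Cons j js)
    then have "ipd_real (j # js) (g []) x = pd_real j (g js) x"
      using pd_real_cong[of "ipd_real js (g [])" "g js" x j] by simp
    also have "\<dots> = g (j # js) x"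
      unfolding pd_real_def using Cons.prems by (intro DERIV_imp_deriv deriv) auto
    finally show ?case .
  qed simp
  have g0: "(\<lambda>x. \<Sum>k. f k x) = g []" by (simp add: g_def fun_eq_iff)
  show ?thesis
    unfolding smooth_limit_def g0
  proof (intro conjI allI impI)
    show "smooth (\<lambda>x. \<Sum>k<N. f k x)" for N
      by (intro smooth_sum f)
    show "smooth (g [])"
      unfolding smooth_real_on_def
    proof (intro conjI allI impI ballI)
      fix js assume js: "set js \<subseteq> {..m}"
      show "continuous_on \<Omega> (ipd_real js (g []))"
        using continuous_on_eq[OF cont[OF js]] ipd[OF js] by simp
      fix x j assume x: "x \<in> \<Omega>" and j: "j \<le> m"
      show "(\<lambda>t. ipd_real js (g []) (x(j := t))) differentiable (at (x j))"
      proof (rule differentiable_line_cong[where f = "g js"])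
        show "(\<lambda>t. g js (x(j := t))) differentiable (at (x j))"
          using deriv[OF js x j] real_differentiable_def by blast
      qed (use ipd[OF js] x in auto)
    qed
    fix js x assume js: "set js \<subseteq> {..m}" and x: "x \<in> \<Omega>"
    have "ipd_real js (\<lambda>x. \<Sum>k<N. f k x) x = (\<Sum>k<N. ipd_real js (f k) x)" for N
      using ipd_real_lincomb[of "{..<N}" f x js "\<lambda>_. 1"] f x js by simp
    then show "(\<lambda>N. ipd_real js (\<lambda>x. \<Sum>k<N. f k x) x) \<longlonglongrightarrow> ipd_real js (g []) x"
      using sums[OF js x] ipd[OF js x] by (simp add: sums_def)
  qed
qed

end

subsection \<open>First-order Clifford operators\<close>

text \<open>A common form of DX, Dy and the operator DT below.\<close>

definition diff_op :: "nat \<Rightarrow> real \<Rightarrow> (nat \<Rightarrow> real) \<Rightarrow> ((nat \<Rightarrow> real) \<Rightarrow> cl) \<Rightarrow> (nat \<Rightarrow> real) \<Rightarrow> cl" where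
  "diff_op m c d G x = (\<lambda>C. c * pd 0 G x C + (\<Sum>j\<in>{1..m}. d j * cl_mult m (cl_e j) (pd j G x) C))"

lemma DX_diff_op: "DX m = diff_op m 1 (\<lambda>_. 1)"
  by (simp add: fun_eq_iff DX_def diff_op_def)

lemma Dy_diff_op: "Dy m = diff_op m 0 (\<lambda>j. if j \<ge> 2 then 1 else 0)"
proof -
  have "(\<Sum>j\<in>{2..m}. cl_mult m (cl_e j) (pd j G x) C)
      = (\<Sum>j\<in>{1..m}. (if j \<ge> 2 then 1 else 0) * cl_mult m (cl_e j) (pd j G x) C)" for G x C
    by (rule sum.mono_neutral_cong_left) auto
  then show ?thesis
    by (simp add: fun_eq_iff Dy_def diff_op_def)
qed

text \<open>Each coordinate of the result is a linear combination of partial derivatives of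
  coordinates, with x_0 treated as one more index. In this form the statements on real functions
  apply directly.\<close>

lemma diff_op_altdef:
  "diff_op m c d G x C = (\<Sum>j\<in>{..m}. (if j = 0 then c else if C \<subseteq> {1..m} then d j * esgn j C else 0)
      * pd_real j (\<lambda>y. G y (if j = 0 then C else flip j C)) x)"
proof -
  have s: "{..m} = insert 0 {1..m}" by auto
  have "(\<Sum>j\<in>{1..m}. d j * cl_mult m (cl_e j) (pd j G x) C)
    = (\<Sum>j\<in>{1..m}. (if j = 0 then c else if C \<subseteq> {1..m} then d j * esgn j C else 0)
      * pd_real j (\<lambda>y. G y (if j = 0 then C else flip j C)) x)"
    by (intro sum.cong refl) (auto simp: cl_mult_e pd_def)
  then show ?thesis
    unfolding s diff_op_def by (simp add: pd_def)
qed

lemma cl_elem_pd: "(\<And>x. cl_elem m (G x)) \<Longrightarrow> cl_elem m (pd j G x)"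
  by (simp add: cl_elem_def pd_def pd_real_def)

lemma cl_elem_diff_op:
  assumes "\<And>x. cl_elem m (G x)"
  shows "cl_elem m (diff_op m c d G x)"
  using cl_elem_pd[of m G 0 x, OF assms]
  by (auto simp: cl_elem_def diff_op_def cl_mult_e intro!: sum.neutral)

lemma cl_elem_diff_op_power: "(\<And>x. cl_elem m (G x)) \<Longrightarrow> cl_elem m ((diff_op m c d ^^ n) G x)"
  by (induction n arbitrary: x) (auto intro: cl_elem_diff_op)

section \<open>Functions of x_2, ..., x_m and limits of Clifford-valued functions\<close>

definition only_y :: "nat \<Rightarrow> ((nat \<Rightarrow> real) \<Rightarrow> cl) \<Rightarrow> bool" where
  "only_y m G \<longleftrightarrow> (\<forall>x x'. (\<forall>j\<in>{2..m}. x j = x' j) \<longrightarrow> G x = G x')"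

lemma only_y_upd: "only_y m G \<Longrightarrow> j < 2 \<Longrightarrow> G (x(j := t)) = G x"
  unfolding only_y_def by (auto elim!: allE[of _ "x(j := t)"] allE[of _ x])

lemma only_y_Dy:
  assumes "only_y m G"
  shows "only_y m (Dy m G)"
  unfolding only_y_def
proof (intro allI impI)
  fix x x' :: "nat \<Rightarrow> real" assume x: "\<forall>j\<in>{2..m}. x j = x' j"
  have "pd j G x = pd j G x'" if "j \<in> {2..m}" for j
  proof -
    have "G (x(j := t)) = G (x'(j := t))" for t
      using assms x unfolding only_y_def by simp
    then show ?thesis
      using x that by (simp add: pd_def pd_real_def)
  qed
  then show "Dy m G x = Dy m G x'"
    by (simp add: Dy_def)
qed

lemma only_y_Dy_power: "only_y m G \<Longrightarrow> only_y m ((Dy m ^^ n) G)"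
  by (induction n) (auto intro: only_y_Dy)

context open_domain
begin

abbreviation smooth_cl :: "((nat \<Rightarrow> real) \<Rightarrow> cl) \<Rightarrow> bool" where
  "smooth_cl \<equiv> smooth_cl_on m \<Omega>"

definition smooth_cl_limit :: "(nat \<Rightarrow> (nat \<Rightarrow> real) \<Rightarrow> cl) \<Rightarrow> ((nat \<Rightarrow> real) \<Rightarrow> cl) \<Rightarrow> bool" where
  "smooth_cl_limit S F \<longleftrightarrow> (\<forall>C. smooth_limit (\<lambda>k x. S k x C) (\<lambda>x. F x C))"

lemma smooth_cl_limit_tendsto:
  assumes "smooth_cl_limit S F" "x \<in> \<Omega>"
  shows "(\<lambda>k. S k x C) \<longlonglongrightarrow> F x C"
proof -
  have "\<forall>js x. set js \<subseteq> {..m} \<longrightarrow> x \<in> \<Omega> \<longrightarrow>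
      (\<lambda>k. ipd_real js (\<lambda>x. S k x C) x) \<longlonglongrightarrow> ipd_real js (\<lambda>x. F x C) x"
    using assms(1) unfolding smooth_cl_limit_def smooth_limit_def by blast
  from spec[OF this, of "[]"] show ?thesis
    using assms(2) by simp
qed

lemma smooth_cl_limit_lincomb:
  assumes "\<And>i. i \<in> I \<Longrightarrow> smooth_cl_limit (S i) (F i)"
  shows "smooth_cl_limit (\<lambda>k x C. \<Sum>i\<in>I. a i * S i k x C) (\<lambda>x C. \<Sum>i\<in>I. a i * F i x C)"
  unfolding smooth_cl_limit_def
  using assms by (intro allI smooth_limit_lincomb) (simp add: smooth_cl_limit_def)

lemma smooth_cl_lincomb:
  "(\<And>i. i \<in> I \<Longrightarrow> smooth_cl (G i)) \<Longrightarrow> smooth_cl (\<lambda>x C. \<Sum>i\<in>I. a i * G i x C)"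
  unfolding smooth_cl_on_def by (intro allI smooth_sum smooth_scale) auto

lemma smooth_cl_diff_op: "smooth_cl G \<Longrightarrow> smooth_cl (diff_op m c d G)"
  unfolding smooth_cl_on_def diff_op_altdef
  by (intro allI smooth_sum smooth_scale smooth_pd) auto

lemma smooth_cl_diff_op_power: "smooth_cl G \<Longrightarrow> smooth_cl ((diff_op m c d ^^ n) G)"
  by (induction n) (auto intro: smooth_cl_diff_op)

lemma smooth_cl_limit_diff_op:
  "smooth_cl_limit S F \<Longrightarrow> smooth_cl_limit (\<lambda>k. diff_op m c d (S k)) (diff_op m c d F)"
  unfolding smooth_cl_limit_def diff_op_altdef
  by (intro allI smooth_limit_lincomb smooth_limit_pd) auto

lemma smooth_cl_limit_diff_op_power:
  "smooth_cl_limit S F \<Longrightarrow> smooth_cl_limit (\<lambda>k. (diff_op m c d ^^ n) (S k)) ((diff_op m c d ^^ n) F)"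
  by (induction n) (auto intro: smooth_cl_limit_diff_op)

lemma diff_op_cong:
  assumes "\<And>x. x \<in> \<Omega> \<Longrightarrow> G x = H x" "x \<in> \<Omega>"
  shows "diff_op m c d G x = diff_op m c d H x"
proof
  fix C
  show "diff_op m c d G x C = diff_op m c d H x C"
    unfolding diff_op_altdef using assms
    by (intro sum.cong refl arg_cong2[where f = "(*)"] pd_real_cong) auto
qed

lemma diff_op_power_cong:
  assumes "\<And>x. x \<in> \<Omega> \<Longrightarrow> G x = H x" "x \<in> \<Omega>"
  shows "(diff_op m c d ^^ n) G x = (diff_op m c d ^^ n) H x"
  using assms(2)
proof (induction n arbitrary: x)
  case (Suc n)
  show ?case
    unfolding funpow.simps comp_def by (rule diff_op_cong[OF Suc.IH Suc.prems])
qed (use assms in simp)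

lemma diff_op_lincomb:
  assumes "\<And>i. i \<in> I \<Longrightarrow> smooth_cl (G i)" "x \<in> \<Omega>"
  shows "diff_op m c d (\<lambda>x C. \<Sum>i\<in>I. a i * G i x C) x = (\<lambda>C. \<Sum>i\<in>I. a i * diff_op m c d (G i) x C)"
proof
  fix C
  define co where "co j = (if j = 0 then c else if C \<subseteq> {1..m} then d j * esgn j C else 0)" for j
  define fl where "fl j = (if j = 0 then C else flip j C)" for j
  have alt: "diff_op m c d G x C = (\<Sum>j\<in>{..m}. co j * pd_real j (\<lambda>y. G y (fl j)) x)" for G
    by (simp add: diff_op_altdef co_def fl_def)
  have "pd_real j (\<lambda>y. \<Sum>i\<in>I. a i * G i y (fl j)) x = (\<Sum>i\<in>I. a i * pd_real j (\<lambda>y. G i y (fl j)) x)"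
    if "j \<in> {..m}" for j
    using assms that by (intro pd_real_lincomb) (auto simp: smooth_cl_on_def)
  then have "diff_op m c d (\<lambda>x C. \<Sum>i\<in>I. a i * G i x C) x C
      = (\<Sum>j\<in>{..m}. \<Sum>i\<in>I. a i * (co j * pd_real j (\<lambda>y. G i y (fl j)) x))"
    unfolding alt by (intro sum.cong refl) (simp add: sum_distrib_left mult.left_commute)
  also have "\<dots> = (\<Sum>i\<in>I. a i * diff_op m c d (G i) x C)"
    unfolding alt sum_distrib_left by (rule sum.swap)
  finally show "diff_op m c d (\<lambda>x C. \<Sum>i\<in>I. a i * G i x C) x C = (\<Sum>i\<in>I. a i * diff_op m c d (G i) x C)" .
qed

lemma diff_op_power_lincomb:
  assumes "\<And>i. i \<in> I \<Longrightarrow> smooth_cl (G i)" "x \<in> \<Omega>"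
  shows "(diff_op m c d ^^ n) (\<lambda>x C. \<Sum>i\<in>I. a i * G i x C) x
    = (\<lambda>C. \<Sum>i\<in>I. a i * (diff_op m c d ^^ n) (G i) x C)"
  using assms(2)
proof (induction n arbitrary: x)
  case (Suc n)
  have "(diff_op m c d ^^ Suc n) (\<lambda>x C. \<Sum>i\<in>I. a i * G i x C) x
      = diff_op m c d (\<lambda>x C. \<Sum>i\<in>I. a i * (diff_op m c d ^^ n) (G i) x C) x"
    unfolding funpow.simps comp_def by (rule diff_op_cong[OF Suc.IH Suc.prems])
  also have "\<dots> = (\<lambda>C. \<Sum>i\<in>I. a i * diff_op m c d ((diff_op m c d ^^ n) (G i)) x C)"
    using assms(1) Suc.prems by (intro diff_op_lincomb smooth_cl_diff_op_power)
  finally show ?case by simp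
qed simp

section \<open>Dy as a square root of the negative Laplacian\<close>

lemma Lap_cong:
  assumes "\<And>x. x \<in> \<Omega> \<Longrightarrow> G x = H x" "x \<in> \<Omega>"
  shows "Lap m G x = Lap m H x"
proof -
  have "pd_real j (pd_real j (\<lambda>y. G y C)) x = pd_real j (pd_real j (\<lambda>y. H y C)) x" for j C
    using ipd_real_cong[of "\<lambda>y. G y C" "\<lambda>y. H y C" x "[j, j]"] assms by simp
  then show ?thesis
    by (simp add: Lap_def pd_def)
qed

lemma smooth_cl_Lap: "smooth_cl G \<Longrightarrow> smooth_cl (Lap m G)"
  unfolding smooth_cl_on_def Lap_def pd_def by (intro allI smooth_sum smooth_pd) auto

text \<open>The off-diagonal terms cancel in pairs, as mixed derivatives commute and generators
  anticommute.\<close>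

lemma Dy_Dy:
  assumes G: "smooth_cl G" "\<And>x. cl_elem m (G x)" and x: "x \<in> \<Omega>"
  shows "Dy m (Dy m G) x C = - Lap m G x C"
proof -
  define a where "a i j = cl_mult m (cl_e i) (cl_mult m (cl_e j) (pd i (pd j G) x)) C" for i j
  have pdD: "pd i (Dy m G) x = (\<lambda>C. \<Sum>j\<in>{2..m}. cl_mult m (cl_e j) (pd i (pd j G) x) C)"
    if i: "i \<in> {2..m}" for i
  proof
    fix C
    have "pd i (Dy m G) x C = pd_real i (\<lambda>y. \<Sum>j\<in>{2..m}. (if C \<subseteq> {1..m} then esgn j C else 0)
        * pd_real j (\<lambda>y. G y (flip j C)) y) x"
      unfolding pd_def Dy_def by (intro arg_cong[where f = "\<lambda>g. pd_real i g x"] ext sum.cong refl)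
        (auto simp: cl_mult_e pd_def)
    also have "\<dots> = (\<Sum>j\<in>{2..m}. (if C \<subseteq> {1..m} then esgn j C else 0)
        * pd_real i (pd_real j (\<lambda>y. G y (flip j C))) x)"
      using G x i by (intro pd_real_lincomb smooth_pd) (auto simp: smooth_cl_on_def)
    also have "\<dots> = (\<Sum>j\<in>{2..m}. cl_mult m (cl_e j) (pd i (pd j G) x) C)"
      by (intro sum.cong refl) (auto simp: cl_mult_e pd_def)
    finally show "pd i (Dy m G) x C = (\<Sum>j\<in>{2..m}. cl_mult m (cl_e j) (pd i (pd j G) x) C)" .
  qed
  have D: "Dy m (Dy m G) x C = (\<Sum>i\<in>{2..m}. \<Sum>j\<in>{2..m}. a i j)"
    unfolding Dy_def[of m "Dy m G"] a_def
    by (intro sum.cong refl) (auto simp: pdD cl_mult_e sum_distrib_left)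
  also have "(\<Sum>i\<in>{2..m}. \<Sum>j\<in>{2..m}. a i j) = (\<Sum>i\<in>{2..m}. \<Sum>j\<in>{2..m}. a j i)"
    by (rule sum.swap)
  finally have D2: "2 * Dy m (Dy m G) x C = (\<Sum>i\<in>{2..m}. \<Sum>j\<in>{2..m}. a i j + a j i)"
    using D by (simp add: sum.distrib)
  have pair: "a i j + a j i = (if i = j then - 2 * pd i (pd i G) x C else 0)"
    if ij: "i \<in> {2..m}" "j \<in> {2..m}" for i j
  proof (cases "i = j")
    case True
    have "cl_elem m (pd i (pd i G) x)"
      using G(2) by (intro cl_elem_pd)
    then show ?thesis
      using True cl_mult_e_e_same[of m "pd i (pd i G) x" i C] ij by (simp add: a_def)
  next
    case False
    have "pd i (pd j G) x = pd j (pd i G) x"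
      unfolding pd_def using G(1) x ij by (intro ext pd_real_commute) (auto simp: smooth_cl_on_def)
    then show ?thesis
      using False cl_mult_e_e_anticommute[of i m j "pd j (pd i G) x" C] ij by (simp add: a_def)
  qed
  have "2 * Dy m (Dy m G) x C = (\<Sum>i\<in>{2..m}. \<Sum>j\<in>{2..m}. if i = j then - 2 * pd i (pd i G) x C else 0)"
    unfolding D2 by (intro sum.cong refl pair)
  also have "\<dots> = - 2 * Lap m G x C"
    by (simp add: Lap_def sum_distrib_left)
  finally show ?thesis by simp
qed

text \<open>This turns the hypothesis on the n-th power of the Laplacian into the vanishing of
  D^(2n), the form in which it is used.\<close>

lemma Dy_power_even:
  assumes "smooth_cl G" "\<And>x. cl_elem m (G x)" "x \<in> \<Omega>"
  shows "(Dy m ^^ (2 * n)) G x C = (-1) ^ n * (Lap m ^^ n) G x C"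
  using assms(3)
proof (induction n arbitrary: x C)
  case (Suc n)
  let ?H = "(Dy m ^^ (2 * n)) G"
  have "(Dy m ^^ (2 * Suc n)) G x C = Dy m (Dy m ?H) x C"
    by simp
  also have "\<dots> = - Lap m ?H x C"
    using assms Suc.prems smooth_cl_diff_op_power cl_elem_diff_op_power
    by (intro Dy_Dy) (auto simp: Dy_diff_op)
  also have "Lap m ?H x C = Lap m (\<lambda>x C. (-1) ^ n * (Lap m ^^ n) G x C) x C"
    using Lap_cong[of ?H "\<lambda>x C. (-1) ^ n * (Lap m ^^ n) G x C" x] Suc by (simp add: fun_eq_iff)
  also have "\<dots> = (-1) ^ n * Lap m ((Lap m ^^ n) G) x C"
  proof -
    have sm: "smooth_cl ((Lap m ^^ n) G)"
      by (induction n) (use assms in \<open>auto intro: smooth_cl_Lap\<close>)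
    have "ipd_real [j, j] (\<lambda>y. \<Sum>i\<in>{0::nat}. (-1) ^ n * (Lap m ^^ n) G y C) x
        = (\<Sum>i\<in>{0::nat}. (-1) ^ n * ipd_real [j, j] (\<lambda>y. (Lap m ^^ n) G y C) x)" if "j \<in> {2..m}" for j
      using sm Suc.prems that by (intro ipd_real_lincomb) (auto simp: smooth_cl_on_def)
    then show ?thesis
      by (simp add: Lap_def[of m "\<lambda>x C. (-1) ^ n * (Lap m ^^ n) G x C"] Lap_def[of m "(Lap m ^^ n) G"]
          pd_def sum_distrib_left)
  qed
  finally show ?case by simp
qed simp

end

subsection \<open>Building blocks\<close>

text \<open>Divided powers with integer exponent, set to 0 for negative exponents. Differentiation
  then lowers the exponent by one without exception at 0.\<close>

definition divpow :: "int \<Rightarrow> complex \<Rightarrow> complex" where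
  "divpow l z = (if l < 0 then 0 else of_real (1 / fact (nat l)) * z ^ nat l)"

lemma divpow_has_derivative: "(divpow l has_field_derivative divpow (l - 1) z) (at z)"
proof (cases "l \<le> 0")
  case True
  then have "divpow l = (\<lambda>z. if l < 0 then 0 else 1)" "divpow (l - 1) z = 0"
    by (auto simp: divpow_def fun_eq_iff)
  then show ?thesis by simp
next
  case False
  define k where "k = nat (l - 1)"
  have l: "nat l = Suc k" using False by (simp add: k_def)
  have e: "divpow l = (\<lambda>z. of_real (1 / fact (Suc k)) * z ^ Suc k)"
    using False l by (auto simp: divpow_def fun_eq_iff)
  have e': "divpow (l - 1) z = of_real (1 / fact (Suc k)) * (of_nat (Suc k) * z ^ k)"
    using False by (auto simp: divpow_def k_def[symmetric] field_simps simp del: of_nat_Suc)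
  have "((\<lambda>z. z ^ Suc k) has_field_derivative of_nat (Suc k) * z ^ k) (at z)"
    by (auto intro!: derivative_eq_intros simp del: power_Suc)
  then show ?thesis
    unfolding e e' by (rule DERIV_cmult)
qed

lemma cnj_divpow: "cnj (divpow l z) = divpow l (cnj z)"
  by (simp add: divpow_def)

text \<open>The quotient \<open>fact (i - 1) / fact (i + d)\<close> is at most 1. The identity thus
  transfers decay from exponent \<open>i - 1\<close> to the larger exponent
  \<open>i + d\<close>.\<close>

lemma divpow_factor:
  assumes "i \<ge> 1"
  shows "of_real (fact i) * divpow (int i + int d) z
    = of_real (fact i * (fact (i - 1) / fact (i + d))) * (z ^ (d + 1) * divpow (int i - 1) z)"
proof -
  obtain k where i: "i = Suc k" using assms by (cases i) auto
  have "nat (int i + int d) = Suc k + d" "nat (int i - 1) = k" by (auto simp: i)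
  then show ?thesis
    by (simp add: divpow_def i power_add ac_simps)
qed

text \<open>With \<open>\<sigma>\<close> equal to 1 or -1 this is z or its conjugate; a block of
  order \<open>q\<close> uses \<open>\<sigma> = (-1) ^ q\<close>, so both parities are treated at
  once.\<close>

definition zs :: "real \<Rightarrow> (nat \<Rightarrow> real) \<Rightarrow> complex" where
  "zs \<sigma> x = Complex (x 0) (\<sigma> * x 1)"

lemma cnj_zs: "cnj (zs \<sigma> x) = zs (- \<sigma>) x"
  by (simp add: zs_def complex_eq_iff)

lemma zc_of_complex: "zc x = cl_of_complex (zs 1 x)"
  by (simp add: zc_def zs_def cl_of_complex_def fun_eq_iff)

lemma zbar_of_complex: "zbar x = cl_of_complex (zs (-1) x)"
  by (simp add: zbar_def zs_def cl_of_complex_def fun_eq_iff)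

lemma zs_has_derivative:
  "((\<lambda>t. zs \<sigma> (x(j := t))) has_vector_derivative
    (if j = 0 then 1 else if j = 1 then Complex 0 \<sigma> else 0)) (at (x j))"
proof -
  have *: "zs \<sigma> y = of_real (y 0) + of_real (y 1) * Complex 0 \<sigma>" for y
    by (simp add: zs_def complex_eq_iff)
  have of_real: "((\<lambda>t. of_real t :: complex) has_vector_derivative 1) (at t)" for t
    using has_vector_derivative_of_real[OF DERIV_ident] by simp
  consider "j = 0" | "j = 1" | "j \<noteq> 0" "j \<noteq> 1" by blast
  then show ?thesis
  proof cases
    case 1
    then show ?thesis unfolding * by (auto intro!: derivative_eq_intros of_real)
  next
    case 2
    then show ?thesis unfolding * by (auto intro!: derivative_eq_intros of_real)
  next
    case 3
    then show ?thesis unfolding * by simp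
  qed
qed

lemma divpow_zs_has_derivative:
  "((\<lambda>t. divpow l (zs \<sigma> (x(j := t)))) has_vector_derivative
    (if j = 0 then 1 else if j = 1 then Complex 0 \<sigma> else 0) * divpow (l - 1) (zs \<sigma> x)) (at (x j))"
  using field_vector_diff_chain_at[OF zs_has_derivative[of \<sigma> x j] divpow_has_derivative, of l]
  by (simp add: comp_def)

locale clifford_domain = open_domain +
  assumes m_ge_2: "m \<ge> 2"
begin

lemma pd_cmul:
  assumes w: "((\<lambda>t. w (x(j := t))) has_vector_derivative w') (at (x j))"
    and u: "smooth_cl u" and x: "x \<in> \<Omega>" and j: "j \<le> m"
  shows "pd j (\<lambda>x. cmul m (w x) (u x)) x C = cmul m w' (u x) C + cmul m (w x) (pd j u x) C"
proof -
  define \<kappa> where "\<kappa> = (if C \<subseteq> {1..m} then esgn 1 C else 0)"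
  have cm: "cmul m a b C = Re a * b C + Im a * (\<kappa> * b (flip 1 C))" for a b
    using m_ge_2 by (simp add: cmul_def cl_mult_e \<kappa>_def)
  have R: "((\<lambda>t. Re (w (x(j := t)))) has_field_derivative Re w') (at (x j))"
    and I: "((\<lambda>t. Im (w (x(j := t)))) has_field_derivative Im w') (at (x j))"
    using w bounded_linear.has_vector_derivative[OF bounded_linear_Re w]
      bounded_linear.has_vector_derivative[OF bounded_linear_Im w]
    by (simp_all add: has_real_derivative_iff_has_vector_derivative)
  have u': "((\<lambda>t. u (x(j := t)) C) has_field_derivative pd j u x C) (at (x j))" for C
    unfolding pd_def using u x j by (intro smooth_has_pd) (auto simp: smooth_cl_on_def)
  have "((\<lambda>t. cmul m (w (x(j := t))) (u (x(j := t))) C) has_field_derivative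
      (Re w' * u x C + pd j u x C * Re (w x)) + (Im w' * (\<kappa> * u x (flip 1 C))
        + (\<kappa> * pd j u x (flip 1 C)) * Im (w x))) (at (x j))"
    unfolding cm using DERIV_add[OF DERIV_mult[OF R u'] DERIV_mult[OF I DERIV_cmult[OF u', of \<kappa>]]] by simp
  then show ?thesis
    unfolding pd_def[of j "\<lambda>x. cmul m (w x) (u x)"] pd_real_def cm
    by (subst DERIV_imp_deriv, assumption) (simp add: algebra_simps)
qed

lemma smooth_Re_Im_power: "smooth (\<lambda>x. Re (zs \<sigma> x ^ k)) \<and> smooth (\<lambda>x. Im (zs \<sigma> x ^ k))"
proof (induction k)
  case 0
  then show ?case by (simp add: smooth_const)
next
  case (Suc k)
  have "(\<lambda>x. Re (zs \<sigma> x ^ Suc k)) = (\<lambda>x. x 0 * Re (zs \<sigma> x ^ k) + (- \<sigma>) * (x 1 * Im (zs \<sigma> x ^ k)))"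
    "(\<lambda>x. Im (zs \<sigma> x ^ Suc k)) = (\<lambda>x. x 0 * Im (zs \<sigma> x ^ k) + \<sigma> * (x 1 * Re (zs \<sigma> x ^ k)))"
    by (simp_all add: zs_def fun_eq_iff)
  then show ?case
    using Suc by (simp only:) (intro conjI smooth_add smooth_scale smooth_mult smooth_coord; blast)
qed

lemma smooth_cl_cmul:
  assumes "smooth (\<lambda>x. Re (w x))" "smooth (\<lambda>x. Im (w x))" "smooth_cl u"
  shows "smooth_cl (\<lambda>x. cmul m (w x) (u x))"
proof -
  have "cmul m (w x) (u x) C = Re (w x) * u x C
      + Im (w x) * ((if C \<subseteq> {1..m} then esgn 1 C else 0) * u x (flip 1 C))" for x C
    using m_ge_2 by (simp add: cmul_def cl_mult_e)
  then show ?thesis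
    using assms unfolding smooth_cl_on_def by (simp only:) (intro allI smooth_add smooth_mult smooth_const; blast)
qed

lemma smooth_divpow: "smooth (\<lambda>x. Re (divpow l (zs \<sigma> x)))" "smooth (\<lambda>x. Im (divpow l (zs \<sigma> x)))"
proof -
  have e: "divpow l z = of_real (if l < 0 then 0 else 1 / fact (nat l)) * z ^ nat l" for z
    by (simp add: divpow_def)
  have ri: "Re (of_real r * z) = r * Re z" "Im (of_real r * z) = r * Im z" for r z
    by simp_all
  have "(\<lambda>x. Re (divpow l (zs \<sigma> x))) = (\<lambda>x. (if l < 0 then 0 else 1 / fact (nat l)) * Re (zs \<sigma> x ^ nat l))"
    "(\<lambda>x. Im (divpow l (zs \<sigma> x))) = (\<lambda>x. (if l < 0 then 0 else 1 / fact (nat l)) * Im (zs \<sigma> x ^ nat l))"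
    by (simp_all only: e ri)
  then show "smooth (\<lambda>x. Re (divpow l (zs \<sigma> x)))" "smooth (\<lambda>x. Im (divpow l (zs \<sigma> x)))"
    using smooth_Re_Im_power[of \<sigma> "nat l"] by (simp_all only: smooth_scale)
qed

text \<open>The function w(l, q) of the introduction; the conjugation in z for odd q comes from moving D past
  z^l.\<close>

definition block :: "((nat \<Rightarrow> real) \<Rightarrow> cl) \<Rightarrow> int \<Rightarrow> nat \<Rightarrow> (nat \<Rightarrow> real) \<Rightarrow> cl" where
  "block A l q x = cmul m (divpow l (zs ((-1) ^ q) x)) ((Dy m ^^ q) A x)"

definition admissible :: "((nat \<Rightarrow> real) \<Rightarrow> cl) \<Rightarrow> bool" where
  "admissible A \<longleftrightarrow> smooth_cl A \<and> (\<forall>x. cl_elem m (A x)) \<and> only_y m A"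

lemma admissible_Dy_power:
  assumes "admissible A"
  shows "smooth_cl ((Dy m ^^ q) A)" "cl_elem m ((Dy m ^^ q) A x)" "only_y m ((Dy m ^^ q) A)"
  using assms smooth_cl_diff_op_power cl_elem_diff_op_power only_y_Dy_power
  by (auto simp: admissible_def Dy_diff_op)

lemma smooth_cl_block: "admissible A \<Longrightarrow> smooth_cl (block A l q)"
  unfolding block_def by (intro smooth_cl_cmul smooth_divpow admissible_Dy_power)

text \<open>One computation serves three operators: the triple \<open>c\<close>, \<open>d 1\<close>,
  \<open>e\<close> is 1, 1, 1 for \<open>DX\<close>, then 0, 0, 1 for \<open>Dy\<close> and 1, -1, 0
  for \<open>DT\<close>.\<close>

lemma diff_op_block:
  assumes A: "admissible A" and x: "x \<in> \<Omega>" and d: "\<And>j. j \<in> {2..m} \<Longrightarrow> d j = e"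
  shows "diff_op m c d (block A l q) x C
    = (c - d 1 * (-1) ^ q) * block A (l - 1) q x C + e * block A l (Suc q) x C"
proof -
  define u where "u = (Dy m ^^ q) A"
  define \<sigma> :: real where "\<sigma> = (-1) ^ q"
  define w w' where "w = divpow l (zs \<sigma> x)" and "w' = divpow (l - 1) (zs \<sigma> x)"
  have m1: "m \<ge> 1" "m \<ge> 0" using m_ge_2 by auto
  have u: "smooth_cl u" "cl_elem m (u x)" "only_y m u" for x
    unfolding u_def using admissible_Dy_power[OF A] by auto
  have pdb: "pd j (block A l q) x C =
      cmul m ((if j = 0 then 1 else if j = 1 then Complex 0 \<sigma> else 0) * w') (u x) C + cmul m w (pd j u x) C"
    if "j \<le> m" for j C
    unfolding block_def u_def[symmetric] \<sigma>_def[symmetric] w_def w'_def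
    by (rule pd_cmul[OF divpow_zs_has_derivative u(1) x that])
  have pd01: "pd j u x = (\<lambda>C. 0)" if "j < 2" for j
    by (simp add: pd_def pd_real_def only_y_upd[OF u(3) that])
  have cm0: "cmul m v (\<lambda>C. 0) C = 0" "cmul m 0 v' C = 0" for v v' C
    using m1 by (simp_all add: cmul_def cl_mult_e)
  have p0: "pd 0 (block A l q) x C = block A (l - 1) q x C"
  proof -
    have "pd 0 (block A l q) x C = cmul m w' (u x) C"
      using pdb[of 0 C] by (simp add: pd01 cm0)
    then show ?thesis by (simp add: block_def w'_def u_def \<sigma>_def)
  qed
  have "pd 1 (block A l q) x = cmul m (Complex 0 \<sigma> * w') (u x)"
    using pdb[of 1] m1 by (simp add: pd01 cm0 fun_eq_iff)
  then have "cl_mult m (cl_e 1) (pd 1 (block A l q) x) C = cmul m (\<i> * (Complex 0 \<sigma> * w')) (u x) C"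
    using cl_mult_e1_cmul[OF m1(1) u(2)] by simp
  \<comment> \<open>The derivative of \<open>zs \<sigma>\<close> by x_1 is \<open>\<sigma>\<close>
    e_1, and e_1 times it is \<open>- \<sigma>\<close>. This sign is all that distinguishes z from
    its conjugate here.\<close>
  also have "\<i> * (Complex 0 \<sigma> * w') = of_real (- \<sigma>) * w'"
    by (simp add: complex_eq_iff)
  finally have p1: "cl_mult m (cl_e 1) (pd 1 (block A l q) x) C = - \<sigma> * block A (l - 1) q x C"
    by (simp only: cmul_of_real_mult) (simp add: block_def w'_def u_def \<sigma>_def)
  have p2: "cl_mult m (cl_e j) (pd j (block A l q) x) = cmul m (cnj w) (cl_mult m (cl_e j) (pd j u x))"
    if "j \<in> {2..m}" for j
  proof -
    have "pd j (block A l q) x = cmul m w (pd j u x)"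
      using pdb[of j] that by (auto simp: cm0 fun_eq_iff)
    then show ?thesis by (simp add: cl_mult_e_cmul[OF that])
  qed
  have sp: "{1..m} = insert 1 {2..m}" using m_ge_2 by auto
  have "(\<Sum>j\<in>{2..m}. d j * cl_mult m (cl_e j) (pd j (block A l q) x) C)
      = (\<Sum>j\<in>{2..m}. e * cmul m (cnj w) (cl_mult m (cl_e j) (pd j u x)) C)"
    by (intro sum.cong refl) (simp add: p2 d)
  also have "\<dots> = e * cmul m (cnj w) (Dy m u x) C"
  proof -
    have "Dy m u x = (\<lambda>C. \<Sum>j\<in>{2..m}. 1 * cl_mult m (cl_e j) (pd j u x) C)"
      by (simp add: Dy_def)
    then show ?thesis
      by (simp only: cmul_sum[OF m1(1)]) (simp add: sum_distrib_left)
  qed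
  \<comment> \<open>Conjugation turns \<open>zs \<sigma>\<close> into
    \<open>zs (- \<sigma>)\<close>, the variable that belongs to order \<open>Suc q\<close>.\<close>
  also have "cmul m (cnj w) (Dy m u x) C = block A l (Suc q) x C"
    by (simp add: block_def w_def u_def \<sigma>_def cnj_divpow cnj_zs)
  finally show ?thesis
    unfolding diff_op_def sp using m_ge_2 by (simp add: p0 p1[unfolded One_nat_def] \<sigma>_def algebra_simps)
qed

lemma DX_block:
  assumes "admissible A" "x \<in> \<Omega>"
  shows "DX m (block A l q) x C = (1 - (-1) ^ q) * block A (l - 1) q x C + block A l (Suc q) x C"
  unfolding DX_diff_op using diff_op_block[OF assms, of "\<lambda>_. 1" 1 1] by simp

lemma Dy_power_block:
  assumes "admissible A" "x \<in> \<Omega>"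
  shows "(Dy m ^^ r) (block A l q) x = block A l (q + r) x"
  using assms(2)
proof (induction r arbitrary: x)
  case (Suc r)
  have "(Dy m ^^ Suc r) (block A l q) x = Dy m (block A l (q + r)) x"
    unfolding funpow.simps comp_def Dy_diff_op using Suc.IH unfolding Dy_diff_op
    by (rule diff_op_cong[OF _ Suc.prems])
  also have "\<dots> = block A l (q + Suc r) x"
    unfolding Dy_diff_op using diff_op_block[OF assms(1) Suc.prems, of "\<lambda>j. if j \<ge> 2 then 1 else 0" 1 0]
    by (simp add: fun_eq_iff)
  finally show ?case .
qed simp

text \<open>On the plane of 1 and e_1 this is twice the Wirtinger derivative by z, hence the factor
  2 on blocks of even order and 0 on those of odd order.\<close>

definition DT :: "((nat \<Rightarrow> real) \<Rightarrow> cl) \<Rightarrow> (nat \<Rightarrow> real) \<Rightarrow> cl" where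
  "DT = diff_op m 1 (\<lambda>j. if j = 1 then -1 else 0)"

lemma DT_power_block:
  assumes "admissible A" "x \<in> \<Omega>"
  shows "(DT ^^ p) (block A l q) x C = (1 + (-1) ^ q) ^ p * block A (l - int p) q x C"
  using assms(2)
proof (induction p arbitrary: x C)
  case (Suc p)
  have "(DT ^^ Suc p) (block A l q) x = DT (\<lambda>x C. \<Sum>i\<in>{0::nat}. (1 + (-1) ^ q) ^ p * block A (l - int p) q x C) x"
    unfolding funpow.simps comp_def using Suc.IH unfolding DT_def
    by (intro diff_op_cong[OF _ Suc.prems]) (simp add: fun_eq_iff)
  also have "\<dots> = (\<lambda>C. \<Sum>i\<in>{0::nat}. (1 + (-1) ^ q) ^ p * DT (block A (l - int p) q) x C)"
    unfolding DT_def using Suc.prems assms(1) by (intro diff_op_lincomb smooth_cl_block) auto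
  finally show ?case
    using diff_op_block[OF assms(1) Suc.prems, of "\<lambda>j. if j = 1 then -1 else 0" 0 1 "l - int p" q C]
    by (simp add: DT_def algebra_simps)
qed simp

end

subsection \<open>Towers and rearrangement\<close>

text \<open>The coefficient c_j belongs to the antiholomorphic exponent k + off j; off 0 = 0 relies on
  truncated subtraction and accounts for the leading term z^k A_k.\<close>

definition off :: "nat \<Rightarrow> nat" where
  "off j = 2 * j - 1"

definition gcoef :: "nat \<Rightarrow> real" where
  "gcoef j = (if j = 0 then 1 else coef_c j)"

lemma off_0: "off 0 = 0" and gcoef_0: "gcoef 0 = 1"
  by (simp_all add: off_def gcoef_def)

lemma odd_off: "j \<ge> 1 \<Longrightarrow> odd (off j)"
  by (auto simp: off_def)

section \<open>Finite sums: the quadratic relation and delayed columns\<close>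

lemma sum_atMost_0:
  fixes f :: "nat \<Rightarrow> real"
  shows "(\<Sum>j\<le>n. f j) = f 0 + (\<Sum>j\<in>{1..n}. f j)"
proof -
  have "{..n} = insert 0 {1..n}" by auto
  then show ?thesis by simp
qed

text \<open>The relation h^2 = 2 h + t, evaluated under the linear map sending t^s to
  \<open>\<beta> s\<close>. Truncating h at degree \<open>n\<close> does no harm, since
  \<open>\<beta>\<close> vanishes beyond \<open>n\<close>.\<close>

lemma coef_c_double_sum:
  fixes \<beta> :: "nat \<Rightarrow> real"
  assumes \<beta>: "\<And>s. s > n \<Longrightarrow> \<beta> s = 0"
  shows "(\<Sum>i\<in>{1..n}. \<Sum>j\<in>{1..n}. coef_c i * coef_c j * \<beta> (i + j)) = \<beta> 1 + (\<Sum>s\<in>{1..n}. 2 * coef_c s * \<beta> s)"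
proof -
  have "(\<Sum>j\<in>{1..n}. coef_c i * coef_c j * \<beta> (i + j))
      = (\<Sum>s\<in>{1..n}. if i < s then coef_c i * coef_c (s - i) * \<beta> s else 0)" for i
  proof -
    have "(\<Sum>j\<in>{1..n}. coef_c i * coef_c j * \<beta> (i + j))
        = (\<Sum>s\<in>{1+i..n+i}. coef_c i * coef_c (s - i) * \<beta> s)"
      by (rule sum.reindex_bij_witness[of _ "\<lambda>s. s - i" "\<lambda>j. j + i"]) (auto simp: add.commute)
    also have "\<dots> = (\<Sum>s\<in>{1+i..n}. coef_c i * coef_c (s - i) * \<beta> s)"
      using \<beta> by (intro sum.mono_neutral_right) auto
    also have "\<dots> = (\<Sum>s\<in>{1..n}. if i < s then coef_c i * coef_c (s - i) * \<beta> s else 0)"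
      by (intro sum.mono_neutral_cong_left) auto
    finally show ?thesis .
  qed
  then have "(\<Sum>i\<in>{1..n}. \<Sum>j\<in>{1..n}. coef_c i * coef_c j * \<beta> (i + j))
      = (\<Sum>i\<in>{1..n}. \<Sum>s\<in>{1..n}. if i < s then coef_c i * coef_c (s - i) * \<beta> s else 0)"
    by simp
  also have "\<dots> = (\<Sum>s\<in>{1..n}. \<Sum>i\<in>{1..n}. if i < s then coef_c i * coef_c (s - i) * \<beta> s else 0)"
    by (rule sum.swap)
  also have "\<dots> = (\<Sum>s\<in>{1..n}. 2 * coef_c s * \<beta> s + (if s = 1 then \<beta> 1 else 0))"
  proof (intro sum.cong refl)
    fix s assume s: "s \<in> {1..n}"
    have "(\<Sum>i\<in>{1..n}. if i < s then coef_c i * coef_c (s - i) * \<beta> s else 0)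
        = (\<Sum>i\<in>{1..s-1}. coef_c i * coef_c (s - i)) * \<beta> s"
      unfolding sum_distrib_right using s by (intro sum.mono_neutral_cong_right) auto
    \<comment> \<open>For \<open>s = 1\<close> the convolution is empty, and
      \<open>2 * coef_c 1 = -1\<close> cancels the extra \<open>\<beta> 1\<close>.\<close>
    also have "\<dots> = 2 * coef_c s * \<beta> s + (if s = 1 then \<beta> 1 else 0)"
    proof (cases "s = 1")
      case True
      then show ?thesis using coef_c_1 by simp
    next
      case False
      then show ?thesis using s coef_c_convolution[of s] by simp
    qed
    finally show "(\<Sum>i\<in>{1..n}. if i < s then coef_c i * coef_c (s - i) * \<beta> s else 0)
        = 2 * coef_c s * \<beta> s + (if s = 1 then \<beta> 1 else 0)" .
  qed
  also have "\<dots> = (\<Sum>s\<in>{1..n}. 2 * coef_c s * \<beta> s) + (if 1 \<le> n then \<beta> 1 else 0)"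
    by (simp add: sum.distrib)
  finally show ?thesis
    using \<beta>[of 1] by (cases "1 \<le> n") auto
qed

lemma sum_atMost_diff:
  fixes p :: "nat \<Rightarrow> real"
  assumes "r \<le> N"
  shows "(\<Sum>i\<le>N - r. p i) = (\<Sum>i\<le>N. p i) - (\<Sum>s<r. p (N - s))"
  using assms
proof (induction r)
  case (Suc r)
  have "N - r = Suc (N - Suc r)" using Suc.prems by simp
  then have "(\<Sum>i\<le>N - r. p i) = (\<Sum>i\<le>N - Suc r. p i) + p (N - r)"
    by (metis sum.atMost_Suc)
  then show ?case using Suc by simp
qed simp

text \<open>Each row \<open>i\<close> sums to 0, but the column \<open>j\<close> is delayed by
  \<open>off j\<close>. Summing to \<open>N\<close> therefore gives complete rows minus the last
  \<open>off j\<close> entries of each column, and the number of missing entries does not depend on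
  \<open>N\<close>.\<close>

lemma sheared_sum_tendsto_0:
  fixes p :: "nat \<Rightarrow> nat \<Rightarrow> real"
  assumes zero: "\<And>i. (\<Sum>j\<le>n. p j i) = 0" and lim: "\<And>j. p j \<longlonglongrightarrow> 0"
  shows "(\<lambda>N. \<Sum>k\<le>N. \<Sum>j | j \<le> n \<and> off j \<le> k. p j (k - off j)) \<longlonglongrightarrow> 0"
proof -
  have eq: "(\<Sum>k\<le>N. \<Sum>j | j \<le> n \<and> off j \<le> k. p j (k - off j)) = - (\<Sum>j\<le>n. \<Sum>s<off j. p j (N - s))"
    \<comment> \<open>This bound exceeds every delay \<open>off j\<close> with
      \<open>j \<le> n\<close>, so no column is cut off before it starts.\<close>
    if N: "N \<ge> 2 * n" for N
  proof -
    have "(\<Sum>k\<le>N. \<Sum>j | j \<le> n \<and> off j \<le> k. p j (k - off j))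
        = (\<Sum>k\<le>N. \<Sum>j\<le>n. if off j \<le> k then p j (k - off j) else 0)"
      by (intro sum.cong refl sum.mono_neutral_cong_left) auto
    also have "\<dots> = (\<Sum>j\<le>n. \<Sum>k\<le>N. if off j \<le> k then p j (k - off j) else 0)"
      by (rule sum.swap)
    also have "\<dots> = (\<Sum>j\<le>n. (\<Sum>i\<le>N. p j i) - (\<Sum>s<off j. p j (N - s)))"
    proof (intro sum.cong refl)
      fix j assume "j \<in> {..n}"
      then have le: "off j \<le> N" using N by (auto simp: off_def)
      have "(\<Sum>k\<le>N. if off j \<le> k then p j (k - off j) else 0) = (\<Sum>k\<in>{off j..N}. p j (k - off j))"
        by (intro sum.mono_neutral_cong_right) auto
      also have "\<dots> = (\<Sum>i\<le>N - off j. p j i)"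
        using le by (intro sum.reindex_bij_witness[of _ "\<lambda>i. i + off j" "\<lambda>k. k - off j"]) auto
      also have "\<dots> = (\<Sum>i\<le>N. p j i) - (\<Sum>s<off j. p j (N - s))"
        by (rule sum_atMost_diff[OF le])
      finally show "(\<Sum>k\<le>N. if off j \<le> k then p j (k - off j) else 0)
          = (\<Sum>i\<le>N. p j i) - (\<Sum>s<off j. p j (N - s))" .
    qed
    also have "\<dots> = (\<Sum>i\<le>N. \<Sum>j\<le>n. p j i) - (\<Sum>j\<le>n. \<Sum>s<off j. p j (N - s))"
      by (simp add: sum_subtractf sum.swap[of _ "{..n}" "{..N}"])
    finally show ?thesis by (simp add: zero)
  qed
  have "(\<lambda>N. p j (N - s)) \<longlonglongrightarrow> 0" for j s
    using lim[of j] by (rule filterlim_compose) (rule filterlim_minus_const_nat_at_top)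
  then have "(\<lambda>N. - (\<Sum>j\<le>n. \<Sum>s<off j. p j (N - s))) \<longlonglongrightarrow> - (\<Sum>j\<le>n. \<Sum>s<off j. 0)"
    by (intro tendsto_minus tendsto_sum)
  then have "(\<lambda>N. - (\<Sum>j\<le>n. \<Sum>s<off j. p j (N - s))) \<longlonglongrightarrow> 0"
    by simp
  then show ?thesis
    by (rule Lim_transform_eventually) (rule eventually_mono[OF eventually_ge_at_top[of "2 * n"]], simp add: eq)
qed

context clifford_domain
begin

text \<open>The function g of the overview, cut off at \<open>j = n\<close>: the terms beyond have
  order at least \<open>2 * n + 1\<close> and vanish for the functions in question.\<close>

definition tower :: "nat \<Rightarrow> ((nat \<Rightarrow> real) \<Rightarrow> cl) \<Rightarrow> int \<Rightarrow> nat \<Rightarrow> (nat \<Rightarrow> real) \<Rightarrow> cl" where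
  "tower n A k q x = (\<lambda>C. \<Sum>j\<in>{..n}. gcoef j * block A (k + int (off j)) (q + off j) x C)"

lemma smooth_cl_tower: "admissible A \<Longrightarrow> smooth_cl (tower n A k q)"
  unfolding tower_def by (intro smooth_cl_lincomb smooth_cl_block)

lemma DX_tower:
  assumes A: "admissible A" and x: "x \<in> \<Omega>" and q: "even q"
    and nil: "\<And>l r. r \<ge> 2 * n \<Longrightarrow> block A l r x C = 0"
  shows "DX m (tower n A k q) x C = (\<Sum>i\<in>{1..n}. coef_c i * tower n A (k + int (off i)) (q + 2 * i) x C)"
proof -
  \<comment> \<open>\<open>\<beta>\<close> lists the blocks of odd order and \<open>\<gamma>\<close>
    those of even order that occur in the image. The exponent \<open>k + 2 * int s - 2\<close> is
    \<open>k + off s - 1\<close>, as DX lowers it once on odd order.\<close>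
  define \<beta> where "\<beta> s = block A (k + 2 * int s - 2) (q + off s) x C" for s
  have \<beta>: "\<beta> s = 0" if "s > n" for s
    unfolding \<beta>_def using that by (intro nil) (auto simp: off_def)
  define \<gamma> where "\<gamma> i = block A (k + int (off i)) (q + 2 * i) x C" for i
  have "DX m (tower n A k q) x C = (\<Sum>j\<in>{..n}. gcoef j * DX m (block A (k + int (off j)) (q + off j)) x C)"
    unfolding DX_diff_op tower_def using A x by (subst diff_op_lincomb) (auto intro: smooth_cl_block)
  also have "\<dots> = (\<Sum>j\<in>{..n}. gcoef j * ((1 - (-1) ^ (q + off j)) * block A (k + int (off j) - 1) (q + off j) x C
      + block A (k + int (off j)) (Suc (q + off j)) x C))"
    by (simp add: DX_block[OF A x])
  also have "\<dots> = block A k (Suc q) x C + (\<Sum>j\<in>{1..n}. coef_c j * (2 * \<beta> j + \<gamma> j))"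
    unfolding sum_atMost_0
  proof (intro arg_cong2[where f = "(+)"] sum.cong refl)
    show "gcoef 0 * ((1 - (-1) ^ (q + off 0)) * block A (k + int (off 0) - 1) (q + off 0) x C
        + block A (k + int (off 0)) (Suc (q + off 0)) x C) = block A k (Suc q) x C"
      using q by (simp add: off_0 gcoef_0)
    show "gcoef j * ((1 - (-1) ^ (q + off j)) * block A (k + int (off j) - 1) (q + off j) x C
        + block A (k + int (off j)) (Suc (q + off j)) x C) = coef_c j * (2 * \<beta> j + \<gamma> j)" if "j \<in> {1..n}" for j
    proof -
      have 1: "(-1 :: real) ^ (q + off j) = -1"
        using q odd_off[of j] that by simp
      have 2: "k + int (off j) - 1 = k + 2 * int j - 2" "Suc (q + off j) = q + 2 * j"
        using that by (auto simp: off_def)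
      show ?thesis
        unfolding \<beta>_def \<gamma>_def 1 2 using that by (simp add: gcoef_def)
    qed
  qed
  also have "block A k (Suc q) x C = \<beta> 1"
    by (simp add: \<beta>_def off_def)
  also have "\<beta> 1 + (\<Sum>j\<in>{1..n}. coef_c j * (2 * \<beta> j + \<gamma> j))
      = (\<Sum>i\<in>{1..n}. coef_c i * \<gamma> i) + (\<beta> 1 + (\<Sum>s\<in>{1..n}. 2 * coef_c s * \<beta> s))"
    by (simp add: algebra_simps sum.distrib)
  \<comment> \<open>Here the quadratic relation is used: the odd-order part acquires the weights
    \<open>coef_c i * coef_c j\<close>, so that \<open>coef_c i\<close> can be factored out and a
    tower remains.\<close>
  also have "\<beta> 1 + (\<Sum>s\<in>{1..n}. 2 * coef_c s * \<beta> s) = (\<Sum>i\<in>{1..n}. \<Sum>j\<in>{1..n}. coef_c i * coef_c j * \<beta> (i + j))"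
    by (rule coef_c_double_sum[symmetric]) (rule \<beta>)
  also have "(\<Sum>i\<in>{1..n}. coef_c i * \<gamma> i) + (\<Sum>i\<in>{1..n}. \<Sum>j\<in>{1..n}. coef_c i * coef_c j * \<beta> (i + j))
      = (\<Sum>i\<in>{1..n}. coef_c i * (\<gamma> i + (\<Sum>j\<in>{1..n}. coef_c j * \<beta> (i + j))))"
    by (simp add: algebra_simps sum.distrib sum_distrib_left)
  also have "\<dots> = (\<Sum>i\<in>{1..n}. coef_c i * tower n A (k + int (off i)) (q + 2 * i) x C)"
  proof (intro sum.cong refl arg_cong2[where f = "(*)"])
    fix i assume i: "i \<in> {1..n}"
    have *: "coef_c j * \<beta> (i + j) = gcoef j * block A (k + int (off i) + int (off j)) (q + 2 * i + off j) x C"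
      if "j \<in> {1..n}" for j
    proof -
      have 1: "k + 2 * int (i + j) - 2 = k + int (off i) + int (off j)" "q + off (i + j) = q + 2 * i + off j"
        using i that by (auto simp: off_def)
      show ?thesis unfolding \<beta>_def 1 using that by (simp add: gcoef_def)
    qed
    show "\<gamma> i + (\<Sum>j\<in>{1..n}. coef_c j * \<beta> (i + j)) = tower n A (k + int (off i)) (q + 2 * i) x C"
      unfolding tower_def sum_atMost_0
      by (intro arg_cong2[where f = "(+)"] sum.cong refl *) (simp add: off_0 gcoef_0 \<gamma>_def)
  qed
  finally show ?thesis .
qed

lemma DX_power_tower:
  assumes A: "admissible A" and nil: "\<And>l r x C. x \<in> \<Omega> \<Longrightarrow> r \<ge> 2 * n \<Longrightarrow> block A l r x C = 0"
    and "x \<in> \<Omega>" "even q" "2 * r + q \<ge> 2 * n"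
  shows "(DX m ^^ r) (tower n A k q) x C = 0"
  using assms(3-)
proof (induction r arbitrary: k q x C)
  case 0
  then show ?case by (auto simp: tower_def nil intro!: sum.neutral)
next
  case (Suc r)
  let ?H = "\<lambda>x C. \<Sum>i\<in>{1..n}. coef_c i * tower n A (k + int (off i)) (q + 2 * i) x C"
  have "(DX m ^^ Suc r) (tower n A k q) x = (DX m ^^ r) (DX m (tower n A k q)) x"
    by (simp add: funpow_Suc_right del: funpow.simps)
  also have "\<dots> = (DX m ^^ r) ?H x"
    unfolding DX_diff_op
  proof (rule diff_op_power_cong[OF _ Suc.prems(1)])
    fix y assume "y \<in> \<Omega>"
    then show "diff_op m 1 (\<lambda>_. 1) (tower n A k q) y = ?H y"
      using DX_tower[OF A, of y q n _ k] Suc.prems nil unfolding DX_diff_op by auto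
  qed
  also have "\<dots> = (\<lambda>C. \<Sum>i\<in>{1..n}. coef_c i * (DX m ^^ r) (tower n A (k + int (off i)) (q + 2 * i)) x C)"
    unfolding DX_diff_op using A Suc.prems by (intro diff_op_power_lincomb smooth_cl_tower)
  finally have "(DX m ^^ Suc r) (tower n A k q) x C
      = (\<Sum>i\<in>{1..n}. coef_c i * (DX m ^^ r) (tower n A (k + int (off i)) (q + 2 * i)) x C)"
    by simp
  also have "\<dots> = 0"
    using Suc.prems by (intro sum.neutral ballI) (simp add: Suc.IH)
  finally show ?case .
qed

text \<open>DX produces blocks with shifted \<open>d\<close> and \<open>q\<close> and coefficients
  that do not depend on \<open>i\<close>. Decay for all shifts at once is thus preserved;
  \<open>d\<close> must range over \<open>int\<close>, since DX can lower the exponent.\<close>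

lemma DX_power_block_tendsto_0:
  assumes A: "\<And>i. admissible (A i)" and x: "x \<in> \<Omega>"
    and lim: "\<And>d q C. (\<lambda>i. fact i * block (A i) (int i + d) q x C) \<longlonglongrightarrow> 0"
  shows "(\<lambda>i. fact i * (DX m ^^ r) (block (A i) (int i + d) q) x C) \<longlonglongrightarrow> 0"
proof (induction r arbitrary: d q C)
  case 0
  then show ?case using lim by simp
next
  case (Suc r)
  define b where "b = (1 - (-1 :: real) ^ q)"
  have "(DX m ^^ Suc r) (block (A i) (int i + d) q) x C
      = b * (DX m ^^ r) (block (A i) (int i + (d - 1)) q) x C + (DX m ^^ r) (block (A i) (int i + d) (Suc q)) x C" for i
  proof -
    let ?H = "\<lambda>x C. \<Sum>s\<in>{True, False}. (if s then b else 1)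
      * (if s then block (A i) (int i + (d - 1)) q else block (A i) (int i + d) (Suc q)) x C"
    have "(DX m ^^ Suc r) (block (A i) (int i + d) q) x = (DX m ^^ r) (DX m (block (A i) (int i + d) q)) x"
      by (simp add: funpow_Suc_right del: funpow.simps)
    also have "\<dots> = (DX m ^^ r) ?H x"
      unfolding DX_diff_op
    proof (rule diff_op_power_cong[OF _ x])
      fix y assume "y \<in> \<Omega>"
      then show "diff_op m 1 (\<lambda>_. 1) (block (A i) (int i + d) q) y = ?H y"
        using DX_block[OF A, of y i "int i + d" q] unfolding DX_diff_op b_def by (auto simp: algebra_simps)
    qed
    also have "\<dots> = (\<lambda>C. \<Sum>s\<in>{True, False}. (if s then b else 1)
      * (DX m ^^ r) (if s then block (A i) (int i + (d - 1)) q else block (A i) (int i + d) (Suc q)) x C)"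
      unfolding DX_diff_op using A x by (intro diff_op_power_lincomb) (auto intro: smooth_cl_block)
    finally show ?thesis by simp
  qed
  moreover have "(\<lambda>i. b * (fact i * (DX m ^^ r) (block (A i) (int i + (d - 1)) q) x C)
      + fact i * (DX m ^^ r) (block (A i) (int i + d) (Suc q)) x C) \<longlonglongrightarrow> b * 0 + 0"
    by (intro tendsto_add tendsto_mult tendsto_const Suc.IH)
  ultimately show ?case
    by (simp add: algebra_simps)
qed

text \<open>Over j, this collects the parts of the towers of all A_i that carry the exponent k; for k > 0 it is
  the k-th term of the series.\<close>

definition block_sum :: "nat \<Rightarrow> (nat \<Rightarrow> (nat \<Rightarrow> real) \<Rightarrow> cl) \<Rightarrow> nat \<Rightarrow> (nat \<Rightarrow> real) \<Rightarrow> cl" where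
  "block_sum n A k x = (\<lambda>C. \<Sum>j | j \<le> n \<and> off j \<le> k.
     (gcoef j * fact (k - off j)) * block (A (k - off j)) (int k) (off j) x C)"

lemma smooth_cl_block_sum: "(\<And>i. admissible (A i)) \<Longrightarrow> smooth_cl (block_sum n A k)"
  unfolding block_sum_def by (intro smooth_cl_lincomb smooth_cl_block)

lemma cmul_power_eq_divpow: "cmul m (z ^ k) u C = fact k * cmul m (divpow (int k) z) u C"
proof -
  have "z ^ k = of_real (fact k) * divpow (int k) z"
    by (simp add: divpow_def)
  then show ?thesis by (simp only: cmul_of_real_mult)
qed

text \<open>The denominator in \<open>B k\<close> is made for this: multiplied by the k! from z^k =
  k! (z^k / k!), it leaves \<open>fact (k - off j)\<close>. That factor depends only on the index
  \<open>i = k - off j\<close> of the tower the term belongs to.\<close>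

lemma sterm_eq_block_sum:
  assumes A: "\<And>i. admissible (A i)" and k: "k \<ge> 1"
    and B: "\<And>x. B k x = (\<lambda>C. \<Sum>j\<in>{1..min n ((k + 1) div 2)}.
           coef_c j / (fact (2 * j - 1) * real (k choose (k - (2 * j - 1))))
             * ((Dy m ^^ (2 * j - 1)) (A (k - (2 * j - 1))) x) C)"
  shows "sterm m A B k = block_sum n A k"
proof (intro ext)
  fix x C
  let ?J = "{1..min n ((k + 1) div 2)}"
  have m1: "m \<ge> 1" using m_ge_2 by simp
  have Bel: "cl_elem m (B k x)"
    using admissible_Dy_power(2)[OF A] by (auto simp: B cl_elem_def intro!: sum.neutral)
  have Ael: "cl_elem m (A k x)"
    using A by (simp add: admissible_def)
  have 1: "cl_mult m (cl_pow m (zc x) k) (A k x) C = fact k * block (A k) (int k) 0 x C"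
    by (simp add: zc_of_complex cl_pow_of_complex[OF m1] cl_mult_of_complex[OF m1 Ael]
        cmul_power_eq_divpow[of _ k] block_def)
  have "cl_mult m (cl_pow m (zbar x) k) (B k x) C = cmul m (zs (-1) x ^ k) (B k x) C"
    by (simp add: zbar_of_complex cl_pow_of_complex[OF m1] cl_mult_of_complex[OF m1 Bel])
  also have "\<dots> = (\<Sum>j\<in>?J. coef_c j / (fact (2 * j - 1) * real (k choose (k - (2 * j - 1))))
      * cmul m (zs (-1) x ^ k) ((Dy m ^^ (2 * j - 1)) (A (k - (2 * j - 1))) x) C)"
    unfolding B cmul_sum[OF m1] ..
  also have "\<dots> = (\<Sum>j\<in>?J. (gcoef j * fact (k - off j)) * block (A (k - off j)) (int k) (off j) x C)"
  proof (intro sum.cong refl)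
    fix j assume j: "j \<in> ?J"
    then have le: "off j \<le> k" and j1: "j \<ge> 1" by (auto simp: off_def)
    have "fact (k - off j) * fact (off j) * (k choose (k - off j)) = (fact k :: nat)"
      using binomial_fact_lemma[of "k - off j" k] le by (simp add: ac_simps)
    then have "fact (k - off j) * fact (off j) * real (k choose (k - off j)) = fact k"
      by (metis of_nat_fact of_nat_mult)
    moreover have "real (k choose (k - off j)) \<noteq> 0"
      using le by simp
    ultimately have f: "coef_c j / (fact (off j) * real (k choose (k - off j))) * fact k
        = gcoef j * fact (k - off j)"
      using j1 by (simp add: gcoef_def field_simps)
    have s: "(-1 :: real) ^ off j = -1"
      using odd_off[OF j1] by simp
    show "coef_c j / (fact (2 * j - 1) * real (k choose (k - (2 * j - 1))))
        * cmul m (zs (-1) x ^ k) ((Dy m ^^ (2 * j - 1)) (A (k - (2 * j - 1))) x) C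
      = (gcoef j * fact (k - off j)) * block (A (k - off j)) (int k) (off j) x C"
      unfolding off_def[symmetric] cmul_power_eq_divpow[of _ k] block_def s f[symmetric] by simp
  qed
  finally have 2: "cl_mult m (cl_pow m (zbar x) k) (B k x) C
    = (\<Sum>j\<in>?J. (gcoef j * fact (k - off j)) * block (A (k - off j)) (int k) (off j) x C)" .
  \<comment> \<open>For \<open>j \<ge> 1\<close>, \<open>off j \<le> k\<close> means
    \<open>j \<le> (k + 1) div 2\<close>; the additional index 0 is the holomorphic term.\<close>
  have J: "{j. j \<le> n \<and> off j \<le> k} = insert 0 ?J"
    by (auto simp: off_def)
  show "sterm m A B k x C = block_sum n A k x C"
    unfolding sterm_def cl_add_def block_sum_def J 1 2 by (simp add: off_0 gcoef_0)
qed

lemma block_sum_0: "(\<And>i. admissible (A i)) \<Longrightarrow> block_sum n A 0 = A 0"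
proof (intro ext)
  fix x C
  have "{j. j \<le> n \<and> off j \<le> 0} = {0}" by (auto simp: off_def)
  then show "block_sum n A 0 x C = A 0 x C"
    by (simp add: block_sum_def off_0 gcoef_0 block_def divpow_def cmul_def)
qed

text \<open>The operator DT kills the antiholomorphic part of the series and differentiates the
  holomorphic part, so convergence of all derivatives of the full terms controls the functions A_k
  alone.\<close>

lemma Dy_DT_power_block_sum:
  assumes A: "\<And>i. admissible (A i)" and x: "x \<in> \<Omega>" and p: "p \<ge> 1"
  shows "(Dy m ^^ q) ((DT ^^ p) (block_sum n A k)) x C = 2 ^ p * (fact k * block (A k) (int k - int p) q x C)"
proof -
  let ?H = "\<lambda>x C. \<Sum>j\<in>{0::nat}. (2 ^ p * fact k) * block (A k) (int k - int p) 0 x C"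
  have H: "(DT ^^ p) (block_sum n A k) y = ?H y" if y: "y \<in> \<Omega>" for y
  proof
    fix C
    have "(DT ^^ p) (block_sum n A k) y C = (\<Sum>j | j \<le> n \<and> off j \<le> k.
        (gcoef j * fact (k - off j)) * (DT ^^ p) (block (A (k - off j)) (int k) (off j)) y C)"
      unfolding DT_def block_sum_def using A y by (subst diff_op_power_lincomb) (auto intro: smooth_cl_block)
    also have "\<dots> = (\<Sum>j\<in>{0}. (gcoef j * fact (k - off j)) * (DT ^^ p) (block (A (k - off j)) (int k) (off j)) y C)"
    proof (rule sum.mono_neutral_right)
      show "\<forall>j\<in>{j. j \<le> n \<and> off j \<le> k} - {0}.
          gcoef j * fact (k - off j) * (DT ^^ p) (block (A (k - off j)) (int k) (off j)) y C = 0"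
      proof
        fix j assume "j \<in> {j. j \<le> n \<and> off j \<le> k} - {0}"
        then have "odd (off j)" by (intro odd_off) auto
        then show "gcoef j * fact (k - off j) * (DT ^^ p) (block (A (k - off j)) (int k) (off j)) y C = 0"
          using DT_power_block[OF A y, of p "k - off j" "int k" "off j" C] p by simp
      qed
    qed (auto simp: off_0)
    also have "\<dots> = ?H y C"
      using DT_power_block[OF A y, of p k "int k" 0 C] by (simp add: off_0 gcoef_0)
    finally show "(DT ^^ p) (block_sum n A k) y C = ?H y C" .
  qed
  have "(Dy m ^^ q) ((DT ^^ p) (block_sum n A k)) x = (Dy m ^^ q) ?H x"
    unfolding Dy_diff_op by (rule diff_op_power_cong[OF H x])
  also have "\<dots> = (\<lambda>C. \<Sum>j\<in>{0::nat}. (2 ^ p * fact k) * (Dy m ^^ q) (block (A k) (int k - int p) 0) x C)"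
    unfolding Dy_diff_op using A x by (intro diff_op_power_lincomb smooth_cl_block)
  finally show ?thesis
    using Dy_power_block[OF A x, of q k "int k - int p" 0] by simp
qed

text \<open>\<open>DT\<close> has to act at least once to remove the antiholomorphic terms, so it
  reaches only exponents below \<open>i\<close>. Exponents from \<open>i\<close> on are recovered
  from \<open>i - 1\<close> by multiplying by a fixed power of z or its conjugate.\<close>

lemma block_tendsto_0:
  assumes A: "\<And>i. admissible (A i)" and x: "x \<in> \<Omega>"
    and lim: "smooth_cl_limit (\<lambda>k. block_sum n A (Suc k)) (\<lambda>x C. 0)"
  shows "(\<lambda>i. fact i * block (A i) (int i + d) q x C) \<longlonglongrightarrow> 0"
proof -
  have zero: "(diff_op m c e ^^ r) (\<lambda>x C. 0) y = (\<lambda>C. 0)" if "y \<in> \<Omega>" for r c e y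
    using diff_op_power_lincomb[of "{}" "\<lambda>_ _ _. 0" y r c e] that by simp
  have neg: "(\<lambda>i. fact i * block (A i) (int i - int p) q x C) \<longlonglongrightarrow> 0" if p: "p \<ge> 1" for p C
  proof -
    have "smooth_cl_limit (\<lambda>k. (Dy m ^^ q) ((DT ^^ p) (block_sum n A (Suc k)))) ((Dy m ^^ q) ((DT ^^ p) (\<lambda>x C. 0)))"
      unfolding Dy_diff_op DT_def by (intro smooth_cl_limit_diff_op_power lim)
    from smooth_cl_limit_tendsto[OF this x, of C]
    have "(\<lambda>k. (Dy m ^^ q) ((DT ^^ p) (block_sum n A (Suc k))) x C) \<longlonglongrightarrow> (Dy m ^^ q) ((DT ^^ p) (\<lambda>x C. 0)) x C" .
    also have "(Dy m ^^ q) ((DT ^^ p) (\<lambda>x C. 0)) x = (Dy m ^^ q) (\<lambda>x C. 0) x"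
      unfolding Dy_diff_op DT_def by (rule diff_op_power_cong[OF zero x])
    also have "\<dots> = (\<lambda>C. 0)"
      unfolding Dy_diff_op by (rule zero[OF x])
    finally have "(\<lambda>k. 2 ^ p * (fact (Suc k) * block (A (Suc k)) (int (Suc k) - int p) q x C)) \<longlonglongrightarrow> 0"
      unfolding Dy_DT_power_block_sum[OF A x p] .
    then have "(\<lambda>i. 2 ^ p * (fact i * block (A i) (int i - int p) q x C)) \<longlonglongrightarrow> 0"
      \<comment> \<open>The terms of the series start at index 1, which shifts the sequence by
        one.\<close>
      by (rule LIMSEQ_imp_Suc)
    from tendsto_mult_left[OF this, of "1 / 2 ^ p"] show ?thesis
      by simp
  qed
  show ?thesis
  proof (cases "d < 0")
    case True
    then show ?thesis
      using neg[of "nat (- d)"] by simp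
  next
    case False
    define e where "e = nat d"
    define z where "z = zs ((-1) ^ q) x"
    define v where "v i C = fact i * block (A i) (int i - 1) q x C" for i C
    have v: "(\<lambda>i. v i C) \<longlonglongrightarrow> 0" for C
      using neg[of 1 C] by (simp add: v_def)
    have m1: "m \<ge> 1" using m_ge_2 by simp
    \<comment> \<open>This requires \<open>i \<ge> 1\<close>, because at \<open>i = 0\<close> the
      block of exponent \<open>i - 1\<close> is 0 by convention.\<close>
    have eq: "fact i * block (A i) (int i + d) q x C
        = fact (i - 1) / fact (i + e) * cmul m (z ^ (e + 1)) (v i) C" if i: "i \<ge> 1" for i
    proof -
      define u where "u = (Dy m ^^ q) (A i) x"
      have u: "cl_elem m u" unfolding u_def by (rule admissible_Dy_power[OF A])
      have "int i + d = int i + int e" using False by (simp add: e_def)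
      then have "fact i * block (A i) (int i + d) q x C = cmul m (of_real (fact i) * divpow (int i + int e) z) u C"
        by (simp only: cmul_of_real_mult) (simp add: block_def u_def z_def)
      also have "\<dots> = fact i * (fact (i - 1) / fact (i + e)) * cmul m (z ^ (e + 1)) (cmul m (divpow (int i - 1) z) u) C"
        unfolding divpow_factor[OF i] cmul_of_real_mult cmul_cmul[OF m1 u] ..
      also have "cmul m (divpow (int i - 1) z) u = block (A i) (int i - 1) q x"
        by (simp add: block_def u_def z_def)
      also have "fact i * (fact (i - 1) / fact (i + e)) * cmul m (z ^ (e + 1)) (block (A i) (int i - 1) q x) C
          = fact (i - 1) / fact (i + e) * cmul m (z ^ (e + 1)) (v i) C"
        using m1 by (simp add: cmul_def cl_mult_e v_def algebra_simps)
      finally show ?thesis .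
    qed
    have "(\<lambda>i. cmul m (z ^ (e + 1)) (v i) C) \<longlonglongrightarrow> 0"
    proof -
      have "(\<lambda>i. Re (z ^ (e + 1)) * v i C + Im (z ^ (e + 1)) * ((if C \<subseteq> {1..m} then esgn 1 C else 0) * v i (flip 1 C)))
          \<longlonglongrightarrow> Re (z ^ (e + 1)) * 0 + Im (z ^ (e + 1)) * ((if C \<subseteq> {1..m} then esgn 1 C else 0) * 0)"
        by (intro tendsto_add tendsto_mult tendsto_const v)
      moreover have "cmul m (z ^ (e + 1)) (v i) C = Re (z ^ (e + 1)) * v i C
          + Im (z ^ (e + 1)) * ((if C \<subseteq> {1..m} then esgn 1 C else 0) * v i (flip 1 C))" for i
        using m1 by (simp add: cmul_def cl_mult_e)
      ultimately show ?thesis by (simp only: mult_zero_right add_0_right)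
    qed
    then have "(\<lambda>i. fact (i - 1) / fact (i + e) * cmul m (z ^ (e + 1)) (v i) C) \<longlonglongrightarrow> 0"
    proof (rule Lim_null_comparison[rotated, OF tendsto_rabs_zero])
      show "\<forall>\<^sub>F i in sequentially. norm (fact (i - 1) / fact (i + e) * cmul m (z ^ (e + 1)) (v i) C)
          \<le> \<bar>cmul m (z ^ (e + 1)) (v i) C\<bar>"
      proof (intro always_eventually allI)
        fix i
        have "fact (i - 1) \<le> (fact (i + e) :: real)" by (intro fact_mono) simp
        then have "\<bar>fact (i - 1) / fact (i + e)\<bar> \<le> (1 :: real)" by simp
        then show "norm (fact (i - 1) / fact (i + e) * cmul m (z ^ (e + 1)) (v i) C) \<le> \<bar>cmul m (z ^ (e + 1)) (v i) C\<bar>"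
          unfolding real_norm_def abs_mult by (rule mult_left_le_one_le[rotated 2]) simp_all
      qed
    qed
    then show ?thesis
      by (rule Lim_transform_eventually) (rule eventually_mono[OF eventually_ge_at_top[of 1]], simp add: eq)
  qed
qed

text \<open>Writing the exponent \<open>k\<close> as \<open>(k - off j) + off j\<close> exhibits
  each summand as an entry of row \<open>i = k - off j\<close>, the shape treated by
  \<open>sheared_sum_tendsto_0\<close>.\<close>

lemma DX_power_sum_block_sum:
  assumes A: "\<And>i. admissible (A i)" and x: "x \<in> \<Omega>"
  shows "(DX m ^^ n) (\<lambda>x C. \<Sum>k\<le>N. block_sum n A k x C) x C
    = (\<Sum>k\<le>N. \<Sum>j | j \<le> n \<and> off j \<le> k. gcoef j * (fact (k - off j)
        * (DX m ^^ n) (block (A (k - off j)) (int (k - off j) + int (off j)) (off j)) x C))"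
proof -
  have "(DX m ^^ n) (\<lambda>x C. \<Sum>k\<le>N. 1 * block_sum n A k x C) x
      = (\<lambda>C. \<Sum>k\<le>N. 1 * (DX m ^^ n) (block_sum n A k) x C)"
    unfolding DX_diff_op using x by (intro diff_op_power_lincomb smooth_cl_block_sum A)
  moreover have "(DX m ^^ n) (block_sum n A k) x C = (\<Sum>j | j \<le> n \<and> off j \<le> k. gcoef j * (fact (k - off j)
        * (DX m ^^ n) (block (A (k - off j)) (int (k - off j) + int (off j)) (off j)) x C))" for k
  proof -
    have "(DX m ^^ n) (block_sum n A k) x = (\<lambda>C. \<Sum>j | j \<le> n \<and> off j \<le> k. (gcoef j * fact (k - off j))
        * (DX m ^^ n) (block (A (k - off j)) (int k) (off j)) x C)"
      unfolding DX_diff_op block_sum_def using x by (intro diff_op_power_lincomb smooth_cl_block A)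
    moreover have "int (k - off j) + int (off j) = int k" if "off j \<le> k" for j
      using that by simp
    ultimately show ?thesis by (simp add: mult.assoc)
  qed
  ultimately show ?thesis by simp
qed

end

theorem theorem6:
  fixes m n :: nat
    and \<Omega> :: "(nat \<Rightarrow> real) set"
    and A B :: "nat \<Rightarrow> (nat \<Rightarrow> real) \<Rightarrow> cl"
  assumes m2: "m \<ge> 2"
    and n1: "n \<ge> 1"
    and \<Omega>_open: "open \<Omega>"
    and A_cl: "\<And>k x. cl_elem m (A k x)"
    and A_y: "\<And>k x x'. (\<forall>j\<in>{2..m}. x j = x' j) \<Longrightarrow> A k x = A k x'"
    and A_smooth: "\<And>k. smooth_cl_on m \<Omega> (A k)"
    and A_harm: "\<And>k x. x \<in> \<Omega> \<Longrightarrow> ((Lap m ^^ n) (A k)) x = cl_zero"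
    and B_def: "\<And>k x. k \<ge> 1 \<Longrightarrow> B k x =
        (\<lambda>C. \<Sum>j\<in>{1..min n ((k + 1) div 2)}.
           coef_c j / (fact (2 * j - 1) * real (k choose (k - (2 * j - 1))))
             * ((Dy m ^^ (2 * j - 1)) (A (k - (2 * j - 1))) x) C)"
    and conv: "\<And>js C x. set js \<subseteq> {..m} \<Longrightarrow> x \<in> \<Omega> \<Longrightarrow>
        \<exists>U. open U \<and> x \<in> U \<and> U \<subseteq> \<Omega> \<and>
          uniformly_convergent_on U
            (\<lambda>N y. \<Sum>k<N. ipd_real js (\<lambda>w. sterm m A B (Suc k) w C) y)"
  shows "\<forall>x\<in>\<Omega>. ((DX m ^^ n) (Fser m A B)) x = cl_zero"
proof -
  interpret clifford_domain m \<Omega>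
    using \<Omega>_open m2 by unfold_locales
  have A: "admissible (A i)" for i
    using A_cl A_y A_smooth unfolding admissible_def only_y_def by blast
  have st: "sterm m A B (Suc k) = block_sum n A (Suc k)" for k
    by (rule sterm_eq_block_sum[OF A]) (use B_def[of "Suc k"] in simp_all)
  have nil: "block (A i) l r x C = 0" if x: "x \<in> \<Omega>" and r: "r \<ge> 2 * n" for i l r x C
  proof -
    have "(Dy m ^^ (2 * n)) (A i) y = (\<lambda>C. 0)" if "y \<in> \<Omega>" for y
      using Dy_power_even[OF A_smooth A_cl that, of n i] A_harm[OF that]
      by (simp add: fun_eq_iff cl_zero_def)
    then have "(Dy m ^^ (r - 2 * n)) ((Dy m ^^ (2 * n)) (A i)) x = (Dy m ^^ (r - 2 * n)) (\<lambda>x C. 0) x"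
      unfolding Dy_diff_op by (intro diff_op_power_cong x)
    also have "\<dots> = (\<lambda>C. 0)"
      using diff_op_power_lincomb[of "{}" "\<lambda>_ _ _. 0" x] x unfolding Dy_diff_op by simp
    finally have "(Dy m ^^ r) (A i) x = (\<lambda>C. 0)"
      using r by (simp add: funpow_add[symmetric, unfolded comp_def fun_eq_iff, rule_format])
    then show ?thesis
      using m2 by (simp add: block_def cmul_def cl_mult_e)
  qed
  define S where "S N x C = (\<Sum>k<N. block_sum n A (Suc k) x C)" for N x C
  have S: "smooth_cl_limit S (\<lambda>x C. \<Sum>k. block_sum n A (Suc k) x C)"
    unfolding smooth_cl_limit_def S_def
  proof (intro allI smooth_limit_series)
    show "smooth (\<lambda>x. block_sum n A (Suc k) x C)" for k C
      using smooth_cl_block_sum[of A n "Suc k"] A unfolding smooth_cl_on_def by blast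
  qed (use conv in \<open>simp add: st\<close>)
  \<comment> \<open>The general term is a difference of consecutive partial sums, so it tends to 0
    together with all its derivatives.\<close>
  have terms: "smooth_cl_limit (\<lambda>k. block_sum n A (Suc k)) (\<lambda>x C. 0)"
  proof -
    have "smooth_cl_limit (\<lambda>k. S (Suc k)) (\<lambda>x C. \<Sum>k. block_sum n A (Suc k) x C)"
      using S smooth_limit_Suc[where S = "\<lambda>k x. S k x C" for C] unfolding smooth_cl_limit_def by simp
    have "smooth_cl_limit (\<lambda>k x C. \<Sum>s\<in>{True, False}. (if s then 1 else -1) * (if s then S (Suc k) else S k) x C)
        (\<lambda>x C. \<Sum>s\<in>{True, False}. (if s then 1 else -1) * (\<Sum>k. block_sum n A (Suc k) x C))"
    proof (intro smooth_cl_limit_lincomb)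
      fix s
      show "smooth_cl_limit (\<lambda>k. if s then S (Suc k) else S k) (\<lambda>x C. \<Sum>k. block_sum n A (Suc k) x C)"
        using S \<open>smooth_cl_limit (\<lambda>k. S (Suc k)) _\<close> by (cases s) simp_all
    qed
    then show ?thesis by (simp add: S_def)
  qed
  \<comment> \<open>\<open>block_sum\<close> at 0 is \<open>A 0\<close>, so the leading term joins
    the partial sums and every row of the rearrangement is complete.\<close>
  have full: "smooth_cl_limit (\<lambda>N x C. \<Sum>k\<le>N. block_sum n A k x C) (Fser m A B)"
  proof -
    have "smooth_cl_limit (\<lambda>k. A 0) (A 0)"
      using A_smooth[of 0] unfolding smooth_cl_limit_def smooth_cl_on_def by (simp add: smooth_limit_const)
    have "smooth_cl_limit (\<lambda>N x C. \<Sum>s\<in>{True, False}. 1 * (if s then A 0 else S N) x C)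
        (\<lambda>x C. \<Sum>s\<in>{True, False}. 1 * (if s then A 0 else (\<lambda>x C. \<Sum>k. block_sum n A (Suc k) x C)) x C)"
    proof (intro smooth_cl_limit_lincomb)
      fix s
      show "smooth_cl_limit (\<lambda>k. if s then A 0 else S k)
          (if s then A 0 else (\<lambda>x C. \<Sum>k. block_sum n A (Suc k) x C))"
        using S \<open>smooth_cl_limit (\<lambda>k. A 0) _\<close> by (cases s) simp_all
    qed
    moreover have "(\<Sum>k\<le>N. block_sum n A k x C) = A 0 x C + S N x C" for N x C
      unfolding S_def using block_sum_0[of A n, OF A] by (simp add: sum.atMost_shift)
    ultimately show ?thesis by (simp add: Fser_def[abs_def] st)
  qed
  show ?thesis
  proof
    fix x assume x: "x \<in> \<Omega>"
    have "(DX m ^^ n) (Fser m A B) x C = 0" for C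
    proof (rule LIMSEQ_unique)
      show "(\<lambda>N. (DX m ^^ n) (\<lambda>x C. \<Sum>k\<le>N. block_sum n A k x C) x C) \<longlonglongrightarrow> (DX m ^^ n) (Fser m A B) x C"
        unfolding DX_diff_op by (rule smooth_cl_limit_tendsto[OF smooth_cl_limit_diff_op_power[OF full] x])
      \<comment> \<open>Row \<open>i\<close> of \<open>p\<close> sums to \<open>fact i\<close> times
        DX^n of the tower over \<open>A i\<close>, which is 0; column \<open>j\<close> enters the
        series with delay \<open>off j\<close>.\<close>
      define p where "p j i = gcoef j * (fact i * (DX m ^^ n) (block (A i) (int i + int (off j)) (off j)) x C)" for j i
      have "(\<lambda>N. \<Sum>k\<le>N. \<Sum>j | j \<le> n \<and> off j \<le> k. p j (k - off j)) \<longlonglongrightarrow> 0"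
      proof (rule sheared_sum_tendsto_0)
        fix i
        have "(DX m ^^ n) (tower n (A i) (int i) 0) x
            = (\<lambda>C. \<Sum>j\<le>n. gcoef j * (DX m ^^ n) (block (A i) (int i + int (off j)) (0 + off j)) x C)"
          unfolding DX_diff_op tower_def using x by (intro diff_op_power_lincomb smooth_cl_block A)
        then have "(\<Sum>j\<le>n. p j i) = fact i * (DX m ^^ n) (tower n (A i) (int i) 0) x C"
          by (simp add: p_def sum_distrib_left algebra_simps)
        also have "\<dots> = 0"
          using DX_power_tower[OF A nil x, of n 0 n i "int i" C] by simp
        finally show "(\<Sum>j\<le>n. p j i) = 0" .
      next
        fix j
        have "(\<lambda>i. gcoef j * (fact i * (DX m ^^ n) (block (A i) (int i + int (off j)) (off j)) x C)) \<longlonglongrightarrow> gcoef j * 0"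
          by (intro tendsto_mult tendsto_const DX_power_block_tendsto_0 A x block_tendsto_0[OF A x terms])
        then show "p j \<longlonglongrightarrow> 0"
          by (simp add: p_def[abs_def])
      qed
      then show "(\<lambda>N. (DX m ^^ n) (\<lambda>x C. \<Sum>k\<le>N. block_sum n A k x C) x C) \<longlonglongrightarrow> 0"
        unfolding p_def DX_power_sum_block_sum[OF A x] .
    qed
    then show "(DX m ^^ n) (Fser m A B) x = cl_zero"
      by (simp add: fun_eq_iff cl_zero_def)
  qed
qed

end
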